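(* Consider the general linear equation of order $n$ in standard form $$y^{(n)}+c_{n-1}\,y^{(n-1)}+c_{n-2}\,y^{(n-2)}+\dots+c_0\,y=0,$$ and set $c_n=1$. The infinitesimal generators $X_n$ of $G_S$ and $X_n^0$ of $G_c$ have the following expressions, where $f,g,h$ are arbitrary functions of $x$, $\delta_0^k$ denotes the Kronecker delta, and $\binom{m}{l}=0$ for $l>m$. (a) $$X_n=f\,\partial_x+(yg+h)\,\partial_y+\sum_{k=0}^{n-1}\Phi_k^n\,\partial_{c_k},$$ where for $k=0,\dots,n-1$ $$\Phi_k^n=-(n-k)c_kf'+\sum_{j=1}^{n-k}c_{k+j}\left[\binom{k+j}{j+1}f^{(j+1)}-\binom{k+j}{j}g^{(j)}\right]+\delta_0^k\left[-c_k\frac{h}{y}+\sum_{j=1}^{n-k}c_{k+j}\binom{k+j}{j}\frac{h^{(j)}}{y}\right].$$ (b) $$X_n^0=f\,\partial_x+\sum_{k=0}^{n-1}\Phi_k^n\,\partial_{c_k},$$ where for $k=0,\dots,n-1$ $$\Phi_k^n=-(n-k)c_kf'+\sum_{j=1}^{n-k}\left[-\binom{k+j}{j}g^{(j)}+\binom{k+j}{j+1}f^{(j+1)}\right]c_{k+j}.$$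
   Context: $G_S$ denotes the symmetry group of the general linear equation when the coefficients $c_0,\dots,c_{n-1}$ (arbitrary functions of $x$) are regarded as additional dependent variables besides $y$: its infinitesimal generators are the vector fields $X=\xi\partial_x+\eta\partial_y+\sum_k\phi_k\partial_{c_k}$ whose $n$-th prolongation $X^{[n]}$ annihilates $\Delta=y^{(n)}+\sum_{k=0}^{n-1}c_ky^{(k)}$ whenever $\Delta=0$. The equivalence group $G$ of the equation is the pseudo group of invertible point transformations of the form $x=f(z)$, $y=g(z)w(z)$, which preserve the linearity and homogeneity of the equation. $G_c$ is the pseudo group of transformations induced by $G$ through its action on the coefficients of the equation; its generators are obtained from $X_n$ by imposing the minimal set of conditions under which the projection of $X_n$ on the $(x,y)$-space becomes the infinitesimal generator of $G$, and then dropping the $\partial_y$ term.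
   Formalization: In (a) the sum of h^(j)/y terms has a minus sign (the printed plus is false); that every generator of G_S has form (a) is claimed only for n ≥ 2 (false for n = 1). All is real and smooth on an open domain with y ≠ 0 and connected fibres over x. *)

theory Defs
  imports "HOL-Analysis.Analysis"
begin

primrec Ck_on :: "nat \<Rightarrow> 'a::real_normed_vector set \<Rightarrow> ('a \<Rightarrow> 'b::real_normed_vector) \<Rightarrow> bool" where
  "Ck_on 0 S F \<longleftrightarrow> continuous_on S F"
| "Ck_on (Suc k) S F \<longleftrightarrow>
     (\<forall>p\<in>S. F differentiable (at p)) \<and> (\<forall>v. Ck_on k S (\<lambda>p. frechet_derivative F (at p) v))"

definition smooth_on :: "'a::real_normed_vector set \<Rightarrow> ('a \<Rightarrow> 'b::real_normed_vector) \<Rightarrow> bool" where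
  "smooth_on S F \<longleftrightarrow> (\<forall>k. Ck_on k S F)"


(* The order of the equation is n = CARD('n).  The coefficients c_0, ..., c_{n-1} are the
   entries of a vector c :: real ^ 'n, numbered by the library bijection between
   {..<CARD('n)} and UNIV :: 'n set; coef also encodes the convention c_n = 1. *)

definition coef :: "real ^ 'n \<Rightarrow> nat \<Rightarrow> real" where
  "coef c k = (if k = CARD('n) then 1 else c $ from_nat_into UNIV k)"

definition coef_vec :: "(nat \<Rightarrow> real) \<Rightarrow> real ^ 'n" where
  "coef_vec a = (\<chi> i. a (to_nat_on UNIV i))"

lemma coef_coef_vec: "k < CARD('n) \<Longrightarrow> coef (coef_vec a :: real ^ 'n) k = a k"
  using to_nat_on_from_nat_into[of k "UNIV :: 'n set"]
  by (simp add: coef_def coef_vec_def to_nat_on_finite[THEN bij_betw_imp_surj_on])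

lemma coef_vec_coef: "coef_vec (coef c) = (c :: real ^ 'n)"
proof -
  have "to_nat_on UNIV i < CARD('n)" for i :: 'n
    using to_nat_on_finite[of "UNIV :: 'n set"] by (auto simp: bij_betw_def)
  then show ?thesis
    by (simp add: vec_eq_iff coef_def coef_vec_def countable_finite less_imp_neq)
qed


(* A point (x, y, c) of the space of independent and dependent variables is read as (x, u) with
   u = (y, c).  A jet (x, u) carries in u j the j-th derivatives (y^(j), c^(j)); jets are of
   infinite order, but every function to which the operators below are applied depends on
   finitely many of the u j.  A vector field
   xi d/dx + eta d/dy + sum_k phi_k d/dc_k is the map (x, y, c) |-> (xi, eta, phi). *)

type_synonym 'n pt = "real \<times> real \<times> (real ^ 'n)"
type_synonym 'n jet = "real \<times> (nat \<Rightarrow> real \<times> (real ^ 'n))"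

definition base :: "'n jet \<Rightarrow> 'n pt" where
  "base J = (fst J, snd J 0)"

(* the derivation a d/dx + sum_j v j d/du_j applied to F at the jet J *)
definition along :: "('n::finite jet \<Rightarrow> 'b::real_normed_vector) \<Rightarrow> 'n jet \<Rightarrow> 'n jet \<Rightarrow> 'b" where
  "along F J V =
     vector_derivative (\<lambda>t. F (fst J + t * fst V, \<lambda>j. snd J j + t *\<^sub>R snd V j)) (at 0)"

(* D = d/dx + sum_j u_(j+1) d/du_j *)
definition total_deriv :: "('n::finite jet \<Rightarrow> 'b::real_normed_vector) \<Rightarrow> 'n jet \<Rightarrow> 'b" where
  "total_deriv F J = along F J (1, \<lambda>j. snd J (Suc j))"

(* coefficients of the prolongation for all dependent variables at once:
   zeta^(j+1) = D zeta^(j) - u_(j+1) D xi *)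
primrec prolong_coeff :: "('n::finite pt \<Rightarrow> 'n pt) \<Rightarrow> nat \<Rightarrow> 'n jet \<Rightarrow> real \<times> (real ^ 'n)" where
  "prolong_coeff X 0 = (\<lambda>J. snd (X (base J)))"
| "prolong_coeff X (Suc j) = (\<lambda>J. total_deriv (prolong_coeff X j) J
     - total_deriv (\<lambda>J. fst (X (base J))) J *\<^sub>R snd J (Suc j))"

definition prolong :: "nat \<Rightarrow> ('n::finite pt \<Rightarrow> 'n pt) \<Rightarrow> ('n jet \<Rightarrow> real) \<Rightarrow> 'n jet \<Rightarrow> real" where
  "prolong m X F J =
     along F J (fst (X (base J)), \<lambda>j. if j \<le> m then prolong_coeff X j J else 0)"

definition Delta :: "'n::finite jet \<Rightarrow> real" where
  "Delta = (\<lambda>(x, u). fst (u CARD('n)) + (\<Sum>k<CARD('n). coef (snd (u 0)) k * fst (u k)))"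

definition GS_generator :: "'n::finite pt set \<Rightarrow> ('n pt \<Rightarrow> 'n pt) \<Rightarrow> bool" where
  "GS_generator U X \<longleftrightarrow> smooth_on U X \<and>
     (\<forall>J. base J \<in> U \<and> Delta J = 0 \<longrightarrow> prolong CARD('n) X Delta J = 0)"


(* (z, w) |-> (x, y) with x = f(z), y = g(z) w *)
definition equivalence_map :: "(real \<times> real) set \<Rightarrow> (real \<times> real \<Rightarrow> real \<times> real) \<Rightarrow> bool" where
  "equivalence_map N T \<longleftrightarrow> (\<exists>f g.
     smooth_on (fst ` N) f \<and> smooth_on (fst ` N) g \<and> inj_on f (fst ` N) \<and>
     (\<forall>z\<in>fst ` N. deriv f z \<noteq> 0 \<and> g z \<noteq> 0) \<and>
     (\<forall>(z, w)\<in>N. T (z, w) = (f z, g z * w)))"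

(* Infinitesimal generators of the pseudo group G: locally, the derivatives at the identity of
   smooth one-parameter families of transformations in G. *)
definition G_generator :: "(real \<times> real) set \<Rightarrow> (real \<times> real \<Rightarrow> real \<times> real) \<Rightarrow> bool" where
  "G_generator W V \<longleftrightarrow> (\<forall>p\<in>W. \<exists>N e T.
     open N \<and> p \<in> N \<and> N \<subseteq> W \<and> 0 < e \<and>
     smooth_on ({-e<..<e} \<times> N) (\<lambda>(t, q). T t q) \<and>
     (\<forall>t\<in>{-e<..<e}. equivalence_map N (T t)) \<and>
     (\<forall>q\<in>N. T 0 q = q \<and> ((\<lambda>t. T t q) has_vector_derivative V q) (at 0)))"

(* Y is a vector field on (x, c)-space: X without its d/dy term.  The condition on V
   says that X projects to a vector field on (x, y)-space which generates G. *)
definition Gc_generator ::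
  "'n::finite pt set \<Rightarrow> (real \<times> (real ^ 'n) \<Rightarrow> real \<times> (real ^ 'n)) \<Rightarrow> bool" where
  "Gc_generator U Y \<longleftrightarrow> (\<exists>X V. GS_generator U X \<and>
     G_generator ((\<lambda>(x, y, c). (x, y)) ` U) V \<and>
     (\<forall>(x, y, c)\<in>U. case X (x, y, c) of (\<xi>, \<eta>, \<phi>) \<Rightarrow>
        V (x, y) = (\<xi>, \<eta>) \<and> Y (x, c) = (\<xi>, \<phi>)))"


(* Both h-terms are negative: the part of y * Phi_0 that depends on h
   must cancel sum_{j=0}^n c_j h^(j). *)
definition Phi :: "(real \<Rightarrow> real) \<Rightarrow> (real \<Rightarrow> real) \<Rightarrow> (real \<Rightarrow> real) \<Rightarrow>
    real \<Rightarrow> real \<Rightarrow> real ^ 'n \<Rightarrow> nat \<Rightarrow> real" where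
  "Phi f g h x y c k =
     - real (CARD('n) - k) * coef c k * deriv f x
     + (\<Sum>j=1..CARD('n) - k. coef c (k + j) *
          (real ((k + j) choose (j + 1)) * (deriv ^^ (j + 1)) f x
           - real ((k + j) choose j) * (deriv ^^ j) g x))
     + (if k = 0 then 1 else 0) *
         (- coef c k * (h x / y)
          - (\<Sum>j=1..CARD('n) - k. coef c (k + j) * real ((k + j) choose j) *
               ((deriv ^^ j) h x / y)))"

definition X_S :: "(real \<Rightarrow> real) \<Rightarrow> (real \<Rightarrow> real) \<Rightarrow> (real \<Rightarrow> real) \<Rightarrow> 'n::finite pt \<Rightarrow> 'n pt" where
  "X_S f g h = (\<lambda>(x, y, c). (f x, y * g x + h x, coef_vec (Phi f g h x y c)))"

definition Phi0 :: "(real \<Rightarrow> real) \<Rightarrow> (real \<Rightarrow> real) \<Rightarrow> real \<Rightarrow> real ^ 'n \<Rightarrow> nat \<Rightarrow> real" where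
  "Phi0 f g x c k =
     - real (CARD('n) - k) * coef c k * deriv f x
     + (\<Sum>j=1..CARD('n) - k.
          (- real ((k + j) choose j) * (deriv ^^ j) g x
           + real ((k + j) choose (j + 1)) * (deriv ^^ (j + 1)) f x) * coef c (k + j))"

definition X_c :: "(real \<Rightarrow> real) \<Rightarrow> (real \<Rightarrow> real) \<Rightarrow>
    real \<times> (real ^ 'n::finite) \<Rightarrow> real \<times> (real ^ 'n)" where
  "X_c f g = (\<lambda>(x, c). (f x, coef_vec (Phi0 f g x c)))"

end

theory Submission
  imports Defs
begin

text \<open>
  Write \<open>\<zeta>\<^sup>(\<^sup>k\<^sup>)\<close> for the \<open>y\<close>-components of the prolongation of \<open>X = \<xi> \<partial>\<^sub>x + \<eta> \<partial>\<^sub>y + \<Sum>\<phi>\<^sub>k \<partial>\<^bsub>c\<^sub>k\<^esub>\<close>. The symmetry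
  condition is \<open>\<Sum>\<^bsub>k\<le>n\<^esub> c\<^sub>k \<zeta>\<^sup>(\<^sup>k\<^sup>) + \<Sum>\<^bsub>k<n\<^esub> \<phi>\<^sub>k y\<^sup>(\<^sup>k\<^sup>) = 0\<close> on \<open>\<Delta> = 0\<close>, with \<open>c\<^sub>n = 1\<close> (\<open>prolong_Delta\<close>).

  Suppose first that \<open>\<xi> = f(x)\<close> and \<open>\<eta> = g(x) y + h(x)\<close>. The Leibniz rule expands
  \<open>\<zeta>\<^sup>(\<^sup>k\<^sup>) = D\<^sup>k (\<eta> - \<xi> y') + \<xi> y\<^sup>(\<^sup>k\<^sup>+\<^sup>1\<^sup>)\<close>, and collecting the factors of each \<open>y\<^sup>(\<^sup>m\<^sup>)\<close> shows that the left-hand side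
  of the symmetry condition equals \<open>\<Sum>(\<phi>\<^sub>m - \<Phi>\<^sub>m) y\<^sup>(\<^sup>m\<^sup>) + (g - n f') \<Delta>\<close> (\<open>prolong_Delta_affine_field\<close>).
  Hence \<open>\<phi>\<^sub>m = \<Phi>\<^sub>m\<close> gives a symmetry. It is the only choice, because \<open>y', \<dots>, y\<^sup>(\<^sup>n\<^sup>-\<^sup>1\<^sup>)\<close> are free on the
  solution set and \<open>y \<noteq> 0\<close> (\<open>GS_generator_affine_field_unique\<close>).

  It remains to bring \<open>\<xi>\<close> and \<open>\<eta>\<close> into this form when \<open>n \<ge> 2\<close>. The derivative \<open>c\<^sup>(\<^sup>n\<^sup>)\<close> enters the
  symmetry condition only through \<open>(\<eta>\<^sub>c - y' \<xi>\<^sub>c) c\<^sup>(\<^sup>n\<^sup>)\<close>, and \<open>y'\<close> is free, so \<open>\<xi>\<close> and \<open>\<eta>\<close> do not involve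
  \<open>c\<close> locally (\<open>GS_generator_coefficient_free\<close>). On jets whose only nonzero derivatives are \<open>y'\<close>
  and \<open>y\<^sup>(\<^sup>n\<^sup>)\<close>, a second difference in \<open>y'\<close> eliminates the unknown \<open>\<phi>\<^sub>k\<close>. What is left is a linear
  combination of \<open>c\<^sub>0, \<dots>, c\<^sub>n\<close> whose coefficients are independent of \<open>c\<close>, so each coefficient
  vanishes; those of \<open>c\<^sub>1\<close> and \<open>c\<^sub>2\<close> amount to \<open>\<xi>\<^sub>y = 0\<close> and \<open>\<eta>\<^bsub>yy\<^esub> = 0\<close>
  (\<open>GS_generator_second_diff_zero\<close>). Connectedness of the fibres over \<open>x\<close> makes the local
  conclusions global (\<open>GS_generator_affine\<close>).

  For the induced group, being generated by transformations \<open>(z, w) \<mapsto> (f(z), g(z) w)\<close> makes \<open>\<xi>\<close>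
  and \<open>\<eta> / y\<close> functions of \<open>x\<close> directly, with \<open>h = 0\<close>, for every order (\<open>Gc_generator_imp\<close>).
  Conversely, \<open>z + t f(z)\<close> and \<open>(1 + t g(z)) w\<close> form a local family of equivalence transformations with
  the prescribed derivative at \<open>t = 0\<close> (\<open>G_generator_linear\<close>).
\<close>

section \<open>Smooth functions\<close>

lemma Ck_on_SucD:
  assumes "Ck_on (Suc k) S F"
  shows "p \<in> S \<Longrightarrow> (F has_derivative frechet_derivative F (at p)) (at p)"
    and "Ck_on k S (\<lambda>p. frechet_derivative F (at p) v)"
  using assms by (auto simp: frechet_derivative_works)

lemma Ck_on_cong:
  assumes "open S" "\<And>p. p \<in> S \<Longrightarrow> F p = G p" "Ck_on k S F"
  shows "Ck_on k S G"
  using assms(2,3)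
proof (induction k arbitrary: F G)
  case 0
  then show ?case by (simp cong: continuous_on_cong)
next
  case (Suc k)
  have G: "(G has_derivative frechet_derivative F (at p)) (at p)" if "p \<in> S" for p
    using Suc.prems that assms(1) has_derivative_transform_within_open[of F _ p UNIV S G]
    by (auto simp: frechet_derivative_works)
  have "frechet_derivative F (at p) = frechet_derivative G (at p)" if "p \<in> S" for p
    using frechet_derivative_at[OF G[OF that]] .
  then have "Ck_on k S (\<lambda>p. frechet_derivative G (at p) v)" for v
    using Suc.prems(2) by (intro Suc.IH[OF _ Ck_on_SucD(2)[OF Suc.prems(2)]]) auto
  then show ?case
    using G by (auto simp: differentiable_def)
qed

text \<open>The directional derivatives in the definition of \<^const>\<open>Ck_on\<close> are those of the chosen
  derivative \<^const>\<open>frechet_derivative\<close>. Uniqueness of derivatives on an open set lets any other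
  formula for the derivative take their place, which is what makes the inductions below work.\<close>

lemma Ck_on_SucI:
  assumes "open S" "\<And>p. p \<in> S \<Longrightarrow> (F has_derivative F' p) (at p)" "\<And>v. Ck_on k S (\<lambda>p. F' p v)"
  shows "Ck_on (Suc k) S F"
proof -
  have "F' p = frechet_derivative F (at p)" if "p \<in> S" for p
    using frechet_derivative_at[OF assms(2)[OF that]] .
  then have "Ck_on k S (\<lambda>p. frechet_derivative F (at p) v)" for v
    by (intro Ck_on_cong[OF assms(1) _ assms(3)]) simp
  then show ?thesis
    using assms(2) by (auto simp: differentiable_def)
qed

lemma Ck_on_Suc_imp_Ck_on: "Ck_on (Suc k) S F \<Longrightarrow> Ck_on k S F"
proof (induction k arbitrary: F)
  case 0
  then show ?case
    by (auto intro!: continuous_at_imp_continuous_on differentiable_imp_continuous_within)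
next
  case (Suc k)
  then show ?case by (metis Ck_on.simps(2))
qed

lemma Ck_on_subset: "Ck_on k S F \<Longrightarrow> T \<subseteq> S \<Longrightarrow> Ck_on k T F"
  by (induction k arbitrary: F) (auto intro: continuous_on_subset)

lemma Ck_on_const: "open S \<Longrightarrow> Ck_on k S (\<lambda>p. c)"
  by (induction k arbitrary: c) (auto intro!: Ck_on_SucI[where F' = "\<lambda>p v. 0"] simp del: Ck_on.simps(2))

lemma Ck_on_linear:
  assumes "open S" "bounded_linear L" "Ck_on k S F"
  shows "Ck_on k S (\<lambda>p. L (F p))"
  using assms(3)
proof (induction k arbitrary: F)
  case 0
  then show ?case using bounded_linear.continuous_on[OF assms(2)] by simp
next
  case (Suc k)
  show ?case
  proof (rule Ck_on_SucI[where F' = "\<lambda>p v. L (frechet_derivative F (at p) v)"])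
    show "((\<lambda>p. L (F p)) has_derivative (\<lambda>v. L (frechet_derivative F (at p) v))) (at p)" if "p \<in> S" for p
      using bounded_linear.has_derivative[OF assms(2) Ck_on_SucD(1)[OF Suc.prems that]] .
    show "Ck_on k S (\<lambda>p. L (frechet_derivative F (at p) v))" for v
      using Suc.IH Ck_on_SucD(2)[OF Suc.prems] by blast
  qed fact
qed

lemma Ck_on_id: "open S \<Longrightarrow> Ck_on k S (\<lambda>p. p)"
  by (cases k) (auto intro!: Ck_on_SucI[where F' = "\<lambda>p v. v"] Ck_on_const simp del: Ck_on.simps(2))

lemma Ck_on_add:
  assumes "open S" "Ck_on k S F" "Ck_on k S G"
  shows "Ck_on k S (\<lambda>p. F p + G p)"
  using assms(2,3)
proof (induction k arbitrary: F G)
  case 0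
  then show ?case by (simp add: continuous_on_add)
next
  case (Suc k)
  show ?case
    by (rule Ck_on_SucI[OF assms(1) has_derivative_add[OF Ck_on_SucD(1)[OF Suc.prems(1)] Ck_on_SucD(1)[OF Suc.prems(2)]]])
      (auto intro: Suc.IH Ck_on_SucD(2)[OF Suc.prems(1)] Ck_on_SucD(2)[OF Suc.prems(2)])
qed

lemma Ck_on_scaleR:
  assumes "open S" "Ck_on k S a" "Ck_on k S F"
  shows "Ck_on k S (\<lambda>p. a p *\<^sub>R F p)"
  using assms(2,3)
proof (induction k arbitrary: a F)
  case 0
  then show ?case by (simp add: continuous_on_scaleR)
next
  case (Suc k)
  show ?case
    by (rule Ck_on_SucI[OF assms(1) has_derivative_scaleR[OF Ck_on_SucD(1)[OF Suc.prems(1)] Ck_on_SucD(1)[OF Suc.prems(2)]]])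
      (auto intro!: Suc.IH Ck_on_add[OF assms(1)] Ck_on_SucD(2)[OF Suc.prems(1)] Ck_on_SucD(2)[OF Suc.prems(2)]
         Ck_on_Suc_imp_Ck_on[OF Suc.prems(1)] Ck_on_Suc_imp_Ck_on[OF Suc.prems(2)])
qed

text \<open>The derivative of \<open>f \<circ> a\<close> in direction \<open>v\<close> is the product of the directional derivative of \<open>a\<close>
  and of \<open>f' \<circ> a\<close>, so the induction has to vary \<open>f\<close>. An outer function of one real variable
  suffices: coefficients of the vector fields are sums of products of functions of \<open>x\<close> alone with
  polynomials in \<open>c\<close>, \<open>y\<close> and \<open>1 / y\<close>.\<close>

lemma Ck_on_compose_real:
  fixes f :: "real \<Rightarrow> real"
  assumes "open S" "Ck_on k T f" "Ck_on k S a" "a ` S \<subseteq> T"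
  shows "Ck_on k S (\<lambda>p. f (a p))"
  using assms(2,3)
proof (induction k arbitrary: f)
  case 0
  then show ?case using assms(4) by (auto intro: continuous_on_compose2)
next
  case (Suc k)
  have 1: "(f has_derivative frechet_derivative f (at (a p))) (at (a p))" if "p \<in> S" for p
    using Ck_on_SucD(1)[OF Suc.prems(1), of "a p"] assms(4) that by auto
  have 2: "frechet_derivative f (at (a p)) v = v *\<^sub>R frechet_derivative f (at (a p)) 1" if "p \<in> S" for p v
    using linear_scale[OF has_derivative_linear[OF 1[OF that]], of v 1] by simp
  show ?case
  proof (rule Ck_on_SucI[where F' = "\<lambda>p v. frechet_derivative f (at (a p)) (frechet_derivative a (at p) v)"])
    show "((\<lambda>p. f (a p)) has_derivative (\<lambda>v. frechet_derivative f (at (a p)) (frechet_derivative a (at p) v))) (at p)"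
      if "p \<in> S" for p
      using has_derivative_compose[OF Ck_on_SucD(1)[OF Suc.prems(2) that] 1[OF that]] .
    have "Ck_on k S (\<lambda>p. frechet_derivative a (at p) v *\<^sub>R frechet_derivative f (at (a p)) 1)" for v
      by (rule Ck_on_scaleR[OF assms(1) Ck_on_SucD(2)[OF Suc.prems(2)]
            Suc.IH[OF Ck_on_SucD(2)[OF Suc.prems(1)] Ck_on_Suc_imp_Ck_on[OF Suc.prems(2)]]])
    then show "Ck_on k S (\<lambda>p. frechet_derivative f (at (a p)) (frechet_derivative a (at p) v))" for v
      by (rule Ck_on_cong[OF assms(1), rotated]) (rule 2[symmetric])
  qed fact
qed

lemma Ck_on_inverse_real: "Ck_on k (- {0 :: real}) inverse"
proof (induction k)
  case 0
  show ?case unfolding Ck_on.simps by (intro continuous_on_inverse continuous_on_id) auto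
next
  case (Suc k)
  show ?case
  proof (rule Ck_on_SucI[where F' = "\<lambda>p v. (- v) *\<^sub>R (inverse p *\<^sub>R inverse p)"])
    show "(inverse has_derivative (\<lambda>v. (- v) *\<^sub>R (inverse p *\<^sub>R inverse p))) (at p)" if "p \<in> - {0}" for p :: real
      using that by (auto intro!: derivative_eq_intros)
    show "Ck_on k (- {0 :: real}) (\<lambda>p. (- v) *\<^sub>R (inverse p *\<^sub>R inverse p))" for v :: real
      by (intro Ck_on_scaleR Ck_on_const Suc) auto
  qed auto
qed

lemma smooth_on_cong: "open S \<Longrightarrow> (\<And>p. p \<in> S \<Longrightarrow> F p = G p) \<Longrightarrow> smooth_on S F \<Longrightarrow> smooth_on S G"
  unfolding smooth_on_def by (rule allI, rule Ck_on_cong[of S F G]) auto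

lemma smooth_on_subset: "smooth_on S F \<Longrightarrow> T \<subseteq> S \<Longrightarrow> smooth_on T F"
  by (auto simp: smooth_on_def intro: Ck_on_subset)

lemma smooth_on_const: "open S \<Longrightarrow> smooth_on S (\<lambda>p. c)"
  by (simp add: smooth_on_def Ck_on_const)

lemma smooth_on_id: "open S \<Longrightarrow> smooth_on S (\<lambda>p. p)"
  by (simp add: smooth_on_def Ck_on_id)

lemma smooth_on_linear: "open S \<Longrightarrow> bounded_linear L \<Longrightarrow> smooth_on S F \<Longrightarrow> smooth_on S (\<lambda>p. L (F p))"
  by (simp add: smooth_on_def Ck_on_linear)

lemma smooth_on_add: "open S \<Longrightarrow> smooth_on S F \<Longrightarrow> smooth_on S G \<Longrightarrow> smooth_on S (\<lambda>p. F p + G p)"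
  by (simp add: smooth_on_def Ck_on_add)

lemma smooth_on_scaleR: "open S \<Longrightarrow> smooth_on S a \<Longrightarrow> smooth_on S F \<Longrightarrow> smooth_on S (\<lambda>p. a p *\<^sub>R F p)"
  by (simp add: smooth_on_def Ck_on_scaleR)

lemma smooth_on_compose_real:
  fixes f :: "real \<Rightarrow> real"
  shows "open S \<Longrightarrow> smooth_on T f \<Longrightarrow> smooth_on S a \<Longrightarrow> a ` S \<subseteq> T \<Longrightarrow> smooth_on S (\<lambda>p. f (a p))"
  unfolding smooth_on_def using Ck_on_compose_real by blast

lemma smooth_on_mult:
  fixes a b :: "'a::real_normed_vector \<Rightarrow> real"
  shows "open S \<Longrightarrow> smooth_on S a \<Longrightarrow> smooth_on S b \<Longrightarrow> smooth_on S (\<lambda>p. a p * b p)"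
  using smooth_on_scaleR[of S a b] by simp

lemma smooth_on_minus:
  fixes F :: "'a::real_normed_vector \<Rightarrow> 'b::real_normed_vector"
  shows "open S \<Longrightarrow> smooth_on S F \<Longrightarrow> smooth_on S (\<lambda>p. - F p)"
  using smooth_on_linear[of S uminus F] by (simp add: bounded_linear_minus bounded_linear_ident)

lemma smooth_on_diff:
  fixes F :: "'a::real_normed_vector \<Rightarrow> 'b::real_normed_vector"
  shows "open S \<Longrightarrow> smooth_on S F \<Longrightarrow> smooth_on S G \<Longrightarrow> smooth_on S (\<lambda>p. F p - G p)"
  using smooth_on_add[of S F "\<lambda>p. - G p"] smooth_on_minus[of S G] by simp

lemma smooth_on_divide:
  fixes a b :: "'a::real_normed_vector \<Rightarrow> real"
  assumes "open S" "smooth_on S a" "smooth_on S b" "\<And>p. p \<in> S \<Longrightarrow> b p \<noteq> 0"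
  shows "smooth_on S (\<lambda>p. a p / b p)"
  unfolding divide_inverse
  using assms by (intro smooth_on_mult smooth_on_compose_real[where T = "- {0}" and f = inverse and a = b])
    (auto simp: smooth_on_def Ck_on_inverse_real)

lemma smooth_on_sum:
  assumes "open S" "\<And>i. i \<in> I \<Longrightarrow> smooth_on S (F i)"
  shows "smooth_on S (\<lambda>p. \<Sum>i\<in>I. F i p)"
proof (cases "finite I")
  case True
  then show ?thesis using assms(2)
    by (induction I) (auto intro: smooth_on_add smooth_on_const assms(1))
qed (use assms(1) in \<open>simp add: smooth_on_const\<close>)

lemma smooth_on_componentwise:
  fixes F :: "'a::real_normed_vector \<Rightarrow> 'b::euclidean_space"
  assumes "open S" "\<And>b. b \<in> Basis \<Longrightarrow> smooth_on S (\<lambda>p. F p \<bullet> b)"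
  shows "smooth_on S F"
proof -
  have "smooth_on S (\<lambda>p. \<Sum>b\<in>Basis. (F p \<bullet> b) *\<^sub>R b)"
    using assms by (intro smooth_on_sum smooth_on_scaleR smooth_on_const)
  then show ?thesis by (simp add: euclidean_representation)
qed

lemma smooth_on_Pair:
  fixes F :: "'a::real_normed_vector \<Rightarrow> 'b::real_normed_vector" and G :: "'a \<Rightarrow> 'c::real_normed_vector"
  assumes "open S" "smooth_on S F" "smooth_on S G"
  shows "smooth_on S (\<lambda>p. (F p, G p))"
proof -
  have "bounded_linear (\<lambda>a::'b. (a, 0::'c))" "bounded_linear (\<lambda>b::'c. (0::'b, b))"
    by (auto intro: bounded_linear_Pair bounded_linear_ident bounded_linear_zero)
  from smooth_on_add[OF assms(1) smooth_on_linear[OF assms(1) this(1) assms(2)]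
      smooth_on_linear[OF assms(1) this(2) assms(3)]]
  show ?thesis by simp
qed

lemma smooth_on_fst: "open S \<Longrightarrow> smooth_on S F \<Longrightarrow> smooth_on S (\<lambda>p. fst (F p))"
  by (rule smooth_on_linear[OF _ bounded_linear_fst])

lemma smooth_on_snd: "open S \<Longrightarrow> smooth_on S F \<Longrightarrow> smooth_on S (\<lambda>p. snd (F p))"
  by (rule smooth_on_linear[OF _ bounded_linear_snd])

lemma smooth_on_inner: "open S \<Longrightarrow> smooth_on S F \<Longrightarrow> smooth_on S (\<lambda>p. F p \<bullet> b)"
  by (rule smooth_on_linear[OF _ bounded_linear_inner_left])

lemmas smooth_intros = smooth_on_const smooth_on_id smooth_on_add smooth_on_mult smooth_on_minus
  smooth_on_diff smooth_on_scaleR smooth_on_sum smooth_on_fst smooth_on_snd smooth_on_inner smooth_on_Pair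

lemma smooth_on_has_derivative:
  "smooth_on S F \<Longrightarrow> p \<in> S \<Longrightarrow> (F has_derivative frechet_derivative F (at p)) (at p)"
  unfolding smooth_on_def by (metis Ck_on_SucD(1))

lemma smooth_on_directional:
  "smooth_on S F \<Longrightarrow> smooth_on S (\<lambda>p. frechet_derivative F (at p) v)"
  unfolding smooth_on_def using Ck_on_SucD(2) by blast

lemma smooth_on_has_real_derivative:
  fixes f :: "real \<Rightarrow> real"
  assumes "smooth_on S f" "x \<in> S"
  shows "(f has_real_derivative deriv f x) (at x)"
  using smooth_on_has_derivative[OF assms]
  by (metis DERIV_deriv_iff_real_differentiable differentiable_def)

lemma smooth_on_deriv:
  fixes f :: "real \<Rightarrow> real"
  assumes "open S" "smooth_on S f"
  shows "smooth_on S (deriv f)"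
proof (rule smooth_on_cong[OF assms(1) _ smooth_on_directional[OF assms(2), of 1]])
  fix p assume "p \<in> S"
  then have "frechet_derivative f (at p) = (*) (deriv f p)"
    using smooth_on_has_real_derivative[OF assms(2)] 
    by (metis frechet_derivative_at has_field_derivative_def)
  then show "frechet_derivative f (at p) 1 = deriv f p" by simp
qed

lemma smooth_on_deriv_iterate:
  fixes f :: "real \<Rightarrow> real"
  assumes "open S" "smooth_on S f"
  shows "smooth_on S ((deriv ^^ j) f)"
  by (induction j) (auto intro: assms smooth_on_deriv)

lemma has_real_derivative_deriv_iterate:
  fixes f :: "real \<Rightarrow> real"
  assumes "open S" "smooth_on S f" "x \<in> S"
  shows "((deriv ^^ j) f has_real_derivative (deriv ^^ Suc j) f x) (at x)"
  using smooth_on_has_real_derivative[OF smooth_on_deriv_iterate[OF assms(1,2)] assms(3)] by simp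

text \<open>Smoothness passes from \<open>U\<close> to its image on the \<open>x\<close>-axis because near each point the
  function \<open>g\<close> is \<open>G\<close> restricted to a horizontal line through \<open>U\<close>.\<close>

lemma smooth_on_descend:
  fixes G :: "real \<times> 'a::real_normed_vector \<Rightarrow> real"
  assumes "open U" "smooth_on U G" "\<And>x u. (x, u) \<in> U \<Longrightarrow> G (x, u) = g x"
  shows "smooth_on (fst ` U) g"
proof -
  have op: "open (fst ` U)"
    using assms(1) by (rule open_image_fst)
  have near: "\<exists>A. open A \<and> x \<in> A \<and> (\<forall>x'\<in>A. (x', u) \<in> U)" if xu: "(x, u) \<in> U" for x u
  proof -
    obtain A B where "open A" "(x, u) \<in> A \<times> B" "A \<times> B \<subseteq> U"
      using open_prod_elim[OF assms(1) xu] by metis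
    then show ?thesis by blast
  qed
  have "Ck_on k (fst ` U) g" if "Ck_on k U G" "\<And>x u. (x, u) \<in> U \<Longrightarrow> G (x, u) = g x" for k G g
    using that
  proof (induction k arbitrary: G g)
    case 0
    show ?case unfolding Ck_on.simps
    proof (rule continuous_at_imp_continuous_on, safe)
      fix x u assume xu: "(x, u) \<in> U"
      obtain A where A: "open A" "x \<in> A" "\<forall>x'\<in>A. (x', u) \<in> U" using near[OF xu] by blast
      have "continuous_on A (\<lambda>x'. G (x', u))"
        using A 0(1) by (intro continuous_on_compose2[of U G A "\<lambda>x'. (x', u)"]) (auto intro!: continuous_intros)
      then have "continuous_on A g"
        using A(3) 0(2) by (auto cong: continuous_on_cong)
      then show "isCont g (fst (x, u))" using A by (simp add: continuous_on_eq_continuous_at)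
    qed
  next
    case (Suc k)
    have der: "(g has_derivative (\<lambda>v. frechet_derivative G (at (x, u)) (v, 0))) (at x)" if xu: "(x, u) \<in> U" for x u
    proof -
      obtain A where A: "open A" "x \<in> A" "\<forall>x'\<in>A. (x', u) \<in> U" using near[OF xu] by blast
      have "((\<lambda>x'. (x', u)) has_derivative (\<lambda>v. (v, 0))) (at x)"
        by (auto intro!: derivative_eq_intros)
      from has_derivative_compose[OF this Ck_on_SucD(1)[OF Suc.prems(1) xu]]
      show ?thesis
        by (rule has_derivative_transform_within_open[OF _ A(1,2)]) (use A(3) Suc.prems(2) in auto)
    qed
    have eq: "frechet_derivative G (at (x, u)) (v, 0) = frechet_derivative g (at x) v" if "(x, u) \<in> U" for x u v
      using frechet_derivative_at[OF der[OF that]] by metis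
    show ?case
    proof (rule Ck_on_SucI[OF op])
      show "(g has_derivative frechet_derivative g (at p)) (at p)" if "p \<in> fst ` U" for p
        using der that by (metis (no_types, lifting) frechet_derivative_at imageE prod.collapse)
      show "Ck_on k (fst ` U) (\<lambda>p. frechet_derivative g (at p) v)" for v
        using Ck_on_SucD(2)[OF Suc.prems(1), of "(v, 0)"] eq by (rule Suc.IH)
    qed
  qed
  then show ?thesis
    using assms(2,3) unfolding smooth_on_def by blast
qed

section \<open>Differential functions and prolongations\<close>

text \<open>The operator \<^const>\<open>along\<close> differentiates on straight lines in the space of jets of infinite
  order. This space carries no norm, so differentiability cannot be stated for it directly;
  lines, and the class \<open>diff_fun\<close> below, replace it.\<close>

definition line :: "'n::finite jet \<Rightarrow> 'n jet \<Rightarrow> real \<Rightarrow> 'n jet" where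
  "line J V t = (fst J + t * fst V, \<lambda>j. snd J j + t *\<^sub>R snd V j)"

definition shift_jet :: "'n::finite jet \<Rightarrow> 'n jet" where
  "shift_jet J = (1, \<lambda>j. snd J (Suc j))"

lemma along_line: "along F J V = vector_derivative (\<lambda>t. F (line J V t)) (at 0)"
  by (simp add: along_def line_def)

lemma total_deriv_eq: "total_deriv F J = along F J (shift_jet J)"
  by (simp add: total_deriv_def shift_jet_def)

lemma fst_line [simp]: "fst (line J V t) = fst J + t * fst V"
  and snd_line [simp]: "snd (line J V t) j = snd J j + t *\<^sub>R snd V j"
  and line_0 [simp]: "line J V 0 = J"
  by (simp_all add: line_def)

lemma fst_shift_jet [simp]: "fst (shift_jet J) = 1"
  and snd_shift_jet [simp]: "snd (shift_jet J) j = snd J (Suc j)"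
  by (simp_all add: shift_jet_def)

lemma base_line: "base (line J V t) = base J + t *\<^sub>R base V"
  by (simp add: base_def)

lemma eventually_base_line:
  assumes "open U" "base J \<in> U"
  shows "eventually (\<lambda>t. base (line J V t) \<in> U) (nhds 0)"
proof -
  have "((\<lambda>t. base J + t *\<^sub>R base V) \<longlongrightarrow> base J + 0 *\<^sub>R base V) (nhds 0)"
    by (intro tendsto_intros filterlim_ident)
  then show ?thesis
    using topological_tendstoD[of _ "base J" "nhds 0" U] assms by (simp add: base_line)
qed

text \<open>Derivations are local: only the values over the open set \<open>U\<close> of base points count.\<close>

lemma along_cong:
  assumes "open U" "base J \<in> U" "\<And>J. base J \<in> U \<Longrightarrow> F J = G J"
  shows "along F J V = along G J V"
  unfolding along_line
proof (rule vector_derivative_cong_eq)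
  show "\<forall>\<^sub>F t in nhds 0. t \<in> UNIV \<longrightarrow> F (line J V t) = G (line J V t)"
    using eventually_base_line[OF assms(1,2), of V] by eventually_elim (simp add: assms(3))
qed auto

text \<open>The differential functions over \<open>U\<close>: polynomials in the jet coordinates whose coefficients are
  smooth functions of the base point. They contain the coefficients of a smooth vector field, are
  stable under the total derivative, and a derivation acts on them linearly in the direction.
  The last rule makes membership depend only on the values over \<open>U\<close>.\<close>

inductive diff_fun :: "'n::finite pt set \<Rightarrow> ('n jet \<Rightarrow> real) \<Rightarrow> bool" for U where
  diff_fun_base: "smooth_on U a \<Longrightarrow> diff_fun U (\<lambda>J. a (base J))"
| diff_fun_coord: "diff_fun U (\<lambda>J. snd J j \<bullet> b)"
| diff_fun_add: "diff_fun U F \<Longrightarrow> diff_fun U G \<Longrightarrow> diff_fun U (\<lambda>J. F J + G J)"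
| diff_fun_mult: "diff_fun U F \<Longrightarrow> diff_fun U G \<Longrightarrow> diff_fun U (\<lambda>J. F J * G J)"
| diff_fun_cong: "diff_fun U F \<Longrightarrow> (\<And>J. base J \<in> U \<Longrightarrow> G J = F J) \<Longrightarrow> diff_fun U G"

lemma diff_fun_const: "open U \<Longrightarrow> diff_fun U (\<lambda>J. c)"
  by (rule diff_fun_base) (rule smooth_on_const)

lemma diff_fun_sum:
  assumes "open U" "\<And>i. i \<in> I \<Longrightarrow> diff_fun U (F i)"
  shows "diff_fun U (\<lambda>J. \<Sum>i\<in>I. F i J)"
proof (cases "finite I")
  case True
  then show ?thesis using assms(2)
    by (induction I) (auto intro: diff_fun_add diff_fun_const assms(1))
qed (use assms(1) in \<open>simp add: diff_fun_const\<close>)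

lemma diff_fun_diff:
  assumes "open U" "diff_fun U F" "diff_fun U G"
  shows "diff_fun U (\<lambda>J. F J - G J)"
  using diff_fun_add[OF assms(2) diff_fun_mult[OF diff_fun_const[OF assms(1), of "-1"] assms(3)]] by simp

lemma base_line_has_vector_derivative:
  assumes "smooth_on U a" "base J \<in> U"
  shows "((\<lambda>t. a (base (line J V t))) has_vector_derivative frechet_derivative a (at (base J)) (base V)) (at 0)"
proof -
  have "((\<lambda>t. base J + t *\<^sub>R base V) has_derivative (\<lambda>t. t *\<^sub>R base V)) (at 0)"
    by (auto intro!: derivative_eq_intros)
  from has_derivative_compose[OF this, of a "frechet_derivative a (at (base J))"]
  have "((\<lambda>t. a (base J + t *\<^sub>R base V)) has_derivative
      (\<lambda>t. frechet_derivative a (at (base J)) (t *\<^sub>R base V))) (at 0)"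
    using smooth_on_has_derivative[OF assms] by simp
  moreover have "frechet_derivative a (at (base J)) (t *\<^sub>R base V) = t *\<^sub>R frechet_derivative a (at (base J)) (base V)" for t
    using linear_scale[OF has_derivative_linear[OF smooth_on_has_derivative[OF assms]]] .
  ultimately show ?thesis
    by (simp add: has_vector_derivative_def base_line)
qed

text \<open>Both facts are proved together since each passes through sums and products by the Leibniz
  rule. Linearity in the direction is needed later to isolate the derivative with respect to the
  jet coordinate of highest order.\<close>

lemma diff_fun_has_linear_derivative:
  assumes "diff_fun U F" "open U" "base J \<in> U"
  shows "\<exists>L. (\<forall>V. ((\<lambda>t. F (line J V t)) has_vector_derivative L V) (at 0)) \<and>
             (\<forall>V W t. L (line V W t) = L V + t * L W)"
  using assms(1)
proof induction
  case (diff_fun_base a)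
  have lin: "linear (frechet_derivative a (at (base J)))"
    using has_derivative_linear[OF smooth_on_has_derivative[OF diff_fun_base assms(3)]] .
  show ?case
    by (rule exI[of _ "\<lambda>V. frechet_derivative a (at (base J)) (base V)"])
      (use base_line_has_vector_derivative[OF diff_fun_base assms(3)]
        in \<open>auto simp: base_line linear_add[OF lin] linear_scale[OF lin]\<close>)
next
  case (diff_fun_coord j b)
  show ?case
    by (rule exI[of _ "\<lambda>V. snd V j \<bullet> b"])
      (auto simp: inner_add_left has_vector_derivative_def intro!: derivative_eq_intros)
next
  case (diff_fun_add F G)
  then obtain L M where "\<forall>V. ((\<lambda>t. F (line J V t)) has_vector_derivative L V) (at 0)"
      "\<forall>V W t. L (line V W t) = L V + t * L W"
      "\<forall>V. ((\<lambda>t. G (line J V t)) has_vector_derivative M V) (at 0)"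
      "\<forall>V W t. M (line V W t) = M V + t * M W" by blast
  then show ?case
    by (intro exI[of _ "\<lambda>V. L V + M V"]) (auto simp: algebra_simps intro!: has_vector_derivative_add)
next
  case (diff_fun_mult F G)
  then obtain L M where L: "\<forall>V. ((\<lambda>t. F (line J V t)) has_vector_derivative L V) (at 0)"
      "\<forall>V W t. L (line V W t) = L V + t * L W"
    and M: "\<forall>V. ((\<lambda>t. G (line J V t)) has_vector_derivative M V) (at 0)"
      "\<forall>V W t. M (line V W t) = M V + t * M W" by blast
  have "((\<lambda>t. F (line J V t) * G (line J V t)) has_vector_derivative F J * M V + L V * G J) (at 0)" for V
    using has_vector_derivative_mult[OF spec[OF L(1), of V] spec[OF M(1), of V]] by simp
  then show ?case
    using L(2) M(2) by (intro exI[of _ "\<lambda>V. F J * M V + L V * G J"]) (auto simp: algebra_simps)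
next
  case (diff_fun_cong F G)
  then obtain L where L: "\<forall>V. ((\<lambda>t. F (line J V t)) has_vector_derivative L V) (at 0)"
      "\<forall>V W t. L (line V W t) = L V + t * L W" by blast
  have "((\<lambda>t. G (line J V t)) has_vector_derivative L V) (at 0)" for V
  proof -
    obtain e where e: "e > 0" "\<And>t. \<bar>t\<bar> < e \<Longrightarrow> base (line J V t) \<in> U"
      using eventually_base_line[OF assms(2,3), of V] by (auto simp: eventually_nhds_metric)
    show ?thesis
      by (rule has_vector_derivative_transform_within_open[where S = "ball 0 e" and f = "\<lambda>t. F (line J V t)"])
        (use e diff_fun_cong(2) in \<open>auto intro: L(1)[rule_format]\<close>)
  qed
  with L(2) show ?case by blast
qed

lemma diff_fun_has_derivative_along:
  assumes "diff_fun U F" "open U" "base J \<in> U"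
  shows "((\<lambda>t. F (line J V t)) has_vector_derivative along F J V) (at 0)"
  using diff_fun_has_linear_derivative[OF assms] unfolding along_line
  by (metis vector_derivative_at)

lemma along_linear:
  assumes "diff_fun U F" "open U" "base J \<in> U"
  shows "along F J (line V W t) = along F J V + t * along F J W"
  using diff_fun_has_linear_derivative[OF assms] unfolding along_line
  by (metis vector_derivative_at)

lemma along_base:
  assumes "smooth_on U a" "base J \<in> U"
  shows "along (\<lambda>J. a (base J)) J V = frechet_derivative a (at (base J)) (base V)"
  unfolding along_line using base_line_has_vector_derivative[OF assms] by (rule vector_derivative_at)

lemma along_unique:
  assumes "((\<lambda>t. F (line J V t)) has_vector_derivative d) (at 0)"
  shows "along F J V = d"
  unfolding along_line using assms by (rule vector_derivative_at)

text \<open>A smooth coefficient \<open>a\<close> contributes \<open>a\<^sub>x + u\<^sub>1 \<bullet> a\<^sub>u\<close>, written out over a basis so that it is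
  visibly a polynomial in the coordinates of \<open>u\<^sub>1\<close>.\<close>

lemma diff_fun_total_deriv:
  assumes "diff_fun U F" "open U"
  shows "diff_fun U (total_deriv F)"
  using assms(1)
proof induction
  case (diff_fun_base a)
  let ?d = "\<lambda>v p. frechet_derivative a (at p) v"
  have "diff_fun U (\<lambda>J. ?d (1, 0) (base J) + (\<Sum>b\<in>Basis. (snd J 1 \<bullet> b) * ?d (0, b) (base J)))"
    by (intro diff_fun_add diff_fun_sum diff_fun_mult diff_fun_coord assms(2)
        diff_fun.diff_fun_base smooth_on_directional[OF diff_fun_base])
  then show ?case
  proof (rule diff_fun_cong)
    fix J :: "'a jet" assume J: "base J \<in> U"
    have lin: "linear (\<lambda>v. ?d v (base J))"
      using has_derivative_linear[OF smooth_on_has_derivative[OF diff_fun_base J]] .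
    have "base (shift_jet J) = (1, 0) + (\<Sum>b\<in>Basis. (snd J 1 \<bullet> b) *\<^sub>R (0, b))"
      by (simp add: base_def euclidean_representation prod_eq_iff fst_sum snd_sum)
    then show "total_deriv (\<lambda>J. a (base J)) J
      = ?d (1, 0) (base J) + (\<Sum>b\<in>Basis. (snd J 1 \<bullet> b) * ?d (0, b) (base J))"
      by (simp add: total_deriv_eq along_base[OF diff_fun_base J] linear_add[OF lin] linear_sum[OF lin]
          linear_scale[OF lin] o_def del: scaleR_Pair)
  qed
next
  case (diff_fun_coord j b)
  show ?case
  proof (rule diff_fun_cong[OF diff_fun.diff_fun_coord[of U "Suc j" b]])
    fix J :: "'a jet"
    show "total_deriv (\<lambda>J. snd J j \<bullet> b) J = snd J (Suc j) \<bullet> b"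
      unfolding total_deriv_eq
      by (rule along_unique) (auto simp: inner_add_left has_vector_derivative_def intro!: derivative_eq_intros)
  qed
next
  case (diff_fun_add F G)
  show ?case
  proof (rule diff_fun_cong[OF diff_fun.diff_fun_add[OF diff_fun_add.IH]])
    fix J :: "'a jet" assume "base J \<in> U"
    then show "total_deriv (\<lambda>J. F J + G J) J = total_deriv F J + total_deriv G J"
      unfolding total_deriv_eq
      by (intro along_unique has_vector_derivative_add diff_fun_has_derivative_along[OF _ assms(2)] diff_fun_add.hyps)
  qed
next
  case (diff_fun_mult F G)
  show ?case
  proof (rule diff_fun_cong[OF diff_fun.diff_fun_add[OF diff_fun.diff_fun_mult[OF diff_fun_mult.hyps(1) diff_fun_mult.IH(2)]
        diff_fun.diff_fun_mult[OF diff_fun_mult.IH(1) diff_fun_mult.hyps(2)]]])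
    fix J :: "'a jet" assume J: "base J \<in> U"
    show "total_deriv (\<lambda>J. F J * G J) J = F J * total_deriv G J + total_deriv F J * G J"
      unfolding total_deriv_eq
      using has_vector_derivative_mult[OF diff_fun_has_derivative_along[OF diff_fun_mult.hyps(1) assms(2) J, of "shift_jet J"]
          diff_fun_has_derivative_along[OF diff_fun_mult.hyps(2) assms(2) J, of "shift_jet J"]]
      by (intro along_unique) simp
  qed
next
  case (diff_fun_cong F G)
  show ?case
    by (rule diff_fun.diff_fun_cong[OF diff_fun_cong.IH], unfold total_deriv_eq,
        rule along_cong[OF assms(2)]) (use diff_fun_cong.hyps(2) in auto)
qed

lemma has_vector_derivative_along_vector:
  fixes F :: "'n::finite jet \<Rightarrow> 'b::euclidean_space"
  assumes "open U" "base J \<in> U" "\<And>b. b \<in> Basis \<Longrightarrow> diff_fun U (\<lambda>J. F J \<bullet> b)"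
  shows "((\<lambda>t. F (line J V t)) has_vector_derivative along F J V) (at 0)"
proof -
  have "((\<lambda>t. \<Sum>b\<in>Basis. (F (line J V t) \<bullet> b) *\<^sub>R b) has_vector_derivative
      (\<Sum>b\<in>Basis. along (\<lambda>J. F J \<bullet> b) J V *\<^sub>R b)) (at 0)"
  proof (rule has_vector_derivative_sum)
    fix b :: 'b assume b: "b \<in> Basis"
    have "((\<lambda>t. F (line J V t) \<bullet> b) has_real_derivative along (\<lambda>J. F J \<bullet> b) J V) (at 0)"
      using diff_fun_has_derivative_along[OF assms(3)[OF b] assms(1,2)]
      by (simp add: has_real_derivative_iff_has_vector_derivative)
    from has_vector_derivative_scaleR[OF this has_vector_derivative_const]
    show "((\<lambda>t. (F (line J V t) \<bullet> b) *\<^sub>R b) has_vector_derivative along (\<lambda>J. F J \<bullet> b) J V *\<^sub>R b) (at 0)"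
      by simp
  qed
  then have "((\<lambda>t. F (line J V t)) has_vector_derivative
      (\<Sum>b\<in>Basis. along (\<lambda>J. F J \<bullet> b) J V *\<^sub>R b)) (at 0)"
    by (simp add: euclidean_representation)
  from this and along_unique[OF this] show ?thesis by simp
qed

lemma along_bounded_linear:
  fixes F :: "'n::finite jet \<Rightarrow> 'b::euclidean_space"
  assumes "open U" "base J \<in> U" "\<And>b. b \<in> Basis \<Longrightarrow> diff_fun U (\<lambda>J. F J \<bullet> b)" "bounded_linear L"
  shows "L (along F J V) = along (\<lambda>J. L (F J)) J V"
  by (rule along_unique[symmetric], rule bounded_linear.has_vector_derivative[OF assms(4)],
      rule has_vector_derivative_along_vector[OF assms(1-3)])

text \<open>By this lemma the vector derivatives in \<^const>\<open>prolong_coeff\<close> exist, so they may be taken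
  component by component. The equation sees only the \<open>y\<close>-component.\<close>

lemma diff_fun_prolong_coeff:
  assumes "open U" "smooth_on U X" "b \<in> Basis"
  shows "diff_fun U (\<lambda>J. prolong_coeff X j J \<bullet> b)"
  using assms(3)
proof (induction j arbitrary: b)
  case 0
  show ?case
    using diff_fun_base[of U "\<lambda>p. snd (X p) \<bullet> b"] assms by (simp add: smooth_intros)
next
  case (Suc j)
  have xi: "smooth_on U (\<lambda>p. fst (X p))"
    using assms by (simp add: smooth_intros)
  have "diff_fun U (\<lambda>J. total_deriv (\<lambda>J. prolong_coeff X j J \<bullet> b) J
      - total_deriv (\<lambda>J. fst (X (base J))) J * (snd J (Suc j) \<bullet> b))"
    by (intro diff_fun_diff diff_fun_total_deriv diff_fun_mult diff_fun_coord diff_fun_base[OF xi] Suc assms(1))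
  then show ?case
  proof (rule diff_fun_cong)
    fix J :: "'a jet" assume "base J \<in> U"
    then show "prolong_coeff X (Suc j) J \<bullet> b = total_deriv (\<lambda>J. prolong_coeff X j J \<bullet> b) J
      - total_deriv (\<lambda>J. fst (X (base J))) J * (snd J (Suc j) \<bullet> b)"
      using along_bounded_linear[OF assms(1) _ Suc.IH bounded_linear_inner_left, where V = "shift_jet J" and J = J]
      by (simp add: total_deriv_eq inner_diff_left)
  qed
qed

abbreviation y_coeff :: "('n::finite pt \<Rightarrow> 'n pt) \<Rightarrow> nat \<Rightarrow> 'n jet \<Rightarrow> real" where
  "y_coeff X j J \<equiv> fst (prolong_coeff X j J)"

lemma diff_fun_y_coeff:
  assumes "open U" "smooth_on U X"
  shows "diff_fun U (y_coeff X j)"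
  using diff_fun_prolong_coeff[OF assms, of "(1, 0)" j] by (simp add: inner_prod_def Basis_prod_def)

lemma y_coeff_Suc:
  assumes "open U" "smooth_on U X" "base J \<in> U"
  shows "y_coeff X (Suc j) J = along (y_coeff X j) J (shift_jet J)
    - along (\<lambda>J. fst (X (base J))) J (shift_jet J) * fst (snd J (Suc j))"
  using along_bounded_linear[OF assms(1,3) diff_fun_prolong_coeff[OF assms(1,2)] bounded_linear_fst]
  by (simp add: total_deriv_eq)

lemma prolong_coeff_order:
  assumes "fst J = fst J'" "\<And>i. i \<le> j \<Longrightarrow> snd J i = snd J' i"
  shows "prolong_coeff X j J = prolong_coeff X j J'"
  using assms
proof (induction j arbitrary: J J')
  case 0
  then show ?case by (simp add: base_def)
next
  case (Suc j)
  have "prolong_coeff X j (line J (shift_jet J) t) = prolong_coeff X j (line J' (shift_jet J') t)" for t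
    using Suc.prems by (intro Suc.IH) auto
  moreover have "base (line J (shift_jet J) t) = base (line J' (shift_jet J') t)" for t
    using Suc.prems by (simp add: base_def)
  ultimately show ?case
    using Suc.prems by (simp add: total_deriv_eq along_line)
qed

text \<open>The explicit symmetry condition: \<open>\<Delta>\<close> is linear in the \<open>y\<close>-derivatives and in \<open>c\<close>, so its derivative
  is a sum of two bilinear terms.\<close>

lemma prolong_Delta:
  fixes X :: "'n::finite pt \<Rightarrow> 'n pt"
  assumes "open U" "smooth_on U X" "base J \<in> U"
  shows "prolong CARD('n) X Delta J = y_coeff X CARD('n) J
    + (\<Sum>k<CARD('n). coef (snd (snd J 0)) k * y_coeff X k J)
    + (\<Sum>k<CARD('n). coef (snd (snd (X (base J)))) k * fst (snd J k))"
proof -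
  let ?V = "(fst (X (base J)), \<lambda>j. if j \<le> CARD('n) then prolong_coeff X j J else 0)"
  have coef: "coef (c + t *\<^sub>R d) k = coef c k + t * coef d k" if "k < CARD('n)" for c d :: "real ^ 'n" and k t
    using that by (simp add: coef_def)
  have "((\<lambda>t. Delta (line J ?V t)) has_vector_derivative y_coeff X CARD('n) J
    + (\<Sum>k<CARD('n). coef (snd (snd J 0)) k * y_coeff X k J
        + coef (snd (snd (X (base J)))) k * fst (snd J k))) (at 0)"
    unfolding has_real_derivative_iff_has_vector_derivative[symmetric] Delta_def case_prod_beta
    by (auto simp: coef intro!: derivative_eq_intros sum.cong)
  then show ?thesis
    unfolding prolong_def sum.distrib add.assoc by (rule along_unique)
qed

section \<open>Prolongation of fields that are affine in y\<close>

text \<open>The formal \<open>j\<close>-th total derivative of \<open>a(x) y\<^sup>(\<^sup>p\<^sup>)\<close>.\<close>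

definition leibniz_sum :: "nat \<Rightarrow> (real \<Rightarrow> real) \<Rightarrow> nat \<Rightarrow> 'n::finite jet \<Rightarrow> real" where
  "leibniz_sum j a p J =
     (\<Sum>i\<le>j. real (j choose i) * (deriv ^^ (j - i)) a (fst J) * fst (snd J (i + p)))"

text \<open>Pascal's rule; it turns the termwise derivative of \<open>leibniz_sum\<close> into the next such sum.\<close>

lemma leibniz_step:
  fixes A Y :: "nat \<Rightarrow> real"
  shows "(\<Sum>i\<le>j. real (j choose i) * (A (Suc (j - i)) * Y i + A (j - i) * Y (Suc i)))
    = (\<Sum>i\<le>Suc j. real (Suc j choose i) * A (Suc j - i) * Y i)"
proof -
  have "(\<Sum>i\<le>Suc j. real (Suc j choose i) * A (Suc j - i) * Y i)
      = A (Suc j) * Y 0 + (\<Sum>i\<le>j. real (Suc j choose Suc i) * A (j - i) * Y (Suc i))"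
    by (subst sum.atMost_Suc_shift) simp
  also have "\<dots> = (A (Suc j) * Y 0 + (\<Sum>i\<le>j. real (j choose Suc i) * A (j - i) * Y (Suc i)))
      + (\<Sum>i\<le>j. real (j choose i) * A (j - i) * Y (Suc i))"
    by (simp add: algebra_simps sum.distrib)
  also have "A (Suc j) * Y 0 + (\<Sum>i\<le>j. real (j choose Suc i) * A (j - i) * Y (Suc i))
      = (\<Sum>i\<le>Suc j. real (j choose i) * A (Suc j - i) * Y i)"
    by (subst sum.atMost_Suc_shift) simp
  also have "\<dots> = (\<Sum>i\<le>j. real (j choose i) * A (Suc (j - i)) * Y i)"
    by (simp add: Suc_diff_le)
  finally show ?thesis
    by (simp add: algebra_simps sum.distrib)
qed

lemma deriv_iterate_shift:
  fixes a :: "real \<Rightarrow> real"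
  assumes "open S" "smooth_on S a" "x \<in> S"
  shows "((\<lambda>t. (deriv ^^ i) a (x + t)) has_real_derivative (deriv ^^ Suc i) a x) (at 0)"
  using has_real_derivative_deriv_iterate[OF assms, of i]
    DERIV_shift[of "(deriv ^^ i) a" "(deriv ^^ Suc i) a x" 0 x]
  by (simp add: add.commute)

lemma leibniz_sum_has_vector_derivative:
  assumes "open S" "smooth_on S a" "fst J \<in> S"
  shows "((\<lambda>t. leibniz_sum j a p (line J (shift_jet J) t)) has_vector_derivative leibniz_sum (Suc j) a p J) (at 0)"
proof -
  have a: "((\<lambda>t. (deriv ^^ i) a (fst J + t)) has_real_derivative (deriv ^^ Suc i) a (fst J)) (at 0)" for i
    using deriv_iterate_shift[OF assms] .
  have "((\<lambda>t. leibniz_sum j a p (line J (shift_jet J) t)) has_real_derivative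
      (\<Sum>i\<le>j. real (j choose i) * ((deriv ^^ Suc (j - i)) a (fst J) * fst (snd J (i + p))
         + (deriv ^^ (j - i)) a (fst J) * fst (snd J (Suc i + p))))) (at 0)"
  proof -
    have "((\<lambda>t. real (j choose i) * (deriv ^^ (j - i)) a (fst J + t) * (fst (snd J (i + p)) + t * fst (snd J (Suc (i + p)))))
      has_real_derivative real (j choose i) * ((deriv ^^ Suc (j - i)) a (fst J) * fst (snd J (i + p))
         + (deriv ^^ (j - i)) a (fst J) * fst (snd J (Suc i + p)))) (at 0)" for i
    proof -
      have "((\<lambda>t. fst (snd J (i + p)) + t * fst (snd J (Suc (i + p)))) has_real_derivative fst (snd J (Suc (i + p)))) (at 0)"
        by (auto intro!: derivative_eq_intros)
      from DERIV_cmult[OF DERIV_mult[OF a[of "j - i"] this], of "real (j choose i)"] show ?thesis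
        by (simp add: algebra_simps del: funpow.simps)
    qed
    from DERIV_sum[OF this] show ?thesis
      by (simp add: leibniz_sum_def del: funpow.simps)
  qed
  then show ?thesis
    unfolding leibniz_step[of j "\<lambda>i. (deriv ^^ i) a (fst J)" "\<lambda>i. fst (snd J (i + p))"] leibniz_sum_def
    by (simp add: has_real_derivative_iff_has_vector_derivative)
qed

text \<open>For \<open>\<xi> = f(x)\<close> and \<open>\<eta> = g(x) y + h(x)\<close> this is the classical formula
  \<open>\<zeta>\<^sup>(\<^sup>j\<^sup>) = D\<^sup>j (\<eta> - \<xi> y') + \<xi> y\<^sup>(\<^sup>j\<^sup>+\<^sup>1\<^sup>)\<close> through the characteristic of the field. The characteristic is a
  sum of terms \<open>a(x) y\<^sup>(\<^sup>p\<^sup>)\<close>, to which the Leibniz rule applies.\<close>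

lemma y_coeff_affine_field:
  fixes X :: "'n::finite pt \<Rightarrow> 'n pt"
  assumes "open U" "smooth_on U X"
    and fgh: "smooth_on (fst ` U) f" "smooth_on (fst ` U) g" "smooth_on (fst ` U) h"
    and xi: "\<And>p. p \<in> U \<Longrightarrow> fst (X p) = f (fst p)"
    and eta: "\<And>p. p \<in> U \<Longrightarrow> fst (snd (X p)) = fst (snd p) * g (fst p) + h (fst p)"
    and "base J \<in> U"
  shows "y_coeff X j J = (deriv ^^ j) h (fst J) + leibniz_sum j g 0 J
    - (leibniz_sum j f 1 J - f (fst J) * fst (snd J (Suc j)))"
  using assms(8)
proof (induction j arbitrary: J)
  case 0
  then show ?case
    using eta[of "base J"] by (simp add: base_def leibniz_sum_def algebra_simps)
next
  case (Suc j)
  let ?V = "shift_jet J"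
  have op: "open (fst ` U)" using assms(1) by (rule open_image_fst)
  have x: "fst J \<in> fst ` U" using Suc.prems by (force simp: base_def)
  have a: "((\<lambda>t. (deriv ^^ i) a (fst J + t)) has_vector_derivative (deriv ^^ Suc i) a (fst J)) (at 0)"
    if "smooth_on (fst ` U) a" for i a
    using deriv_iterate_shift[OF op that x, of i]
    by (simp add: has_real_derivative_iff_has_vector_derivative[symmetric])
  have "along (\<lambda>J. fst (X (base J))) J ?V = along (\<lambda>J. f (fst J)) J ?V"
    by (rule along_cong[OF assms(1) Suc.prems]) (simp add: xi, simp add: base_def)
  also have "\<dots> = deriv f (fst J)"
    using a[OF fgh(1), of 0] by (intro along_unique) simp
  finally have D_xi: "along (\<lambda>J. fst (X (base J))) J ?V = deriv f (fst J)" .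
  have f: "((\<lambda>t. f (fst J + t) * (fst (snd J (Suc j)) + t * fst (snd J (Suc (Suc j))))) has_vector_derivative
      deriv f (fst J) * fst (snd J (Suc j)) + f (fst J) * fst (snd J (Suc (Suc j)))) (at 0)"
    using a[OF fgh(1), of 0]
    by (auto simp: has_real_derivative_iff_has_vector_derivative[symmetric] intro!: derivative_eq_intros)
  have "along (y_coeff X j) J ?V = along (\<lambda>J. (deriv ^^ j) h (fst J) + leibniz_sum j g 0 J
    - (leibniz_sum j f 1 J - f (fst J) * fst (snd J (Suc j)))) J ?V"
    by (rule along_cong[OF assms(1) Suc.prems]) (rule Suc.IH)
  also have "\<dots> = (deriv ^^ Suc j) h (fst J) + leibniz_sum (Suc j) g 0 J
    - (leibniz_sum (Suc j) f 1 J - (deriv f (fst J) * fst (snd J (Suc j)) + f (fst J) * fst (snd J (Suc (Suc j)))))"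
    using a[OF fgh(3), of j] f
    by (intro along_unique has_vector_derivative_add has_vector_derivative_diff
        leibniz_sum_has_vector_derivative[OF op _ x] fgh) simp_all
  finally show ?case
    by (simp add: y_coeff_Suc[OF assms(1,2) Suc.prems] D_xi del: prolong_coeff.simps)
qed

text \<open>The factor of \<open>y\<^sup>(\<^sup>m\<^sup>)\<close> in \<open>\<zeta>\<^sup>(\<^sup>k\<^sup>)\<close>, where \<open>d = k - m\<close>. The two binomial coefficients are those in
  the formula for \<open>\<Phi>\<close>.\<close>

definition weight :: "(real \<Rightarrow> real) \<Rightarrow> (real \<Rightarrow> real) \<Rightarrow> real \<Rightarrow> nat \<Rightarrow> nat \<Rightarrow> real" where
  "weight f g x k d =
     real (k choose d) * (deriv ^^ d) g x - real (k choose Suc d) * (deriv ^^ Suc d) f x"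

lemma leibniz_sum_weight:
  "leibniz_sum j g 0 J - (leibniz_sum j f 1 J - f (fst J) * fst (snd J (Suc j)))
     = (\<Sum>m\<le>j. fst (snd J m) * weight f g (fst J) j (j - m))"
proof -
  have "leibniz_sum j f 1 J - f (fst J) * fst (snd J (Suc j))
      = (\<Sum>i<j. real (j choose i) * (deriv ^^ (j - i)) f (fst J) * fst (snd J (Suc i)))"
    by (simp add: leibniz_sum_def flip: lessThan_Suc_atMost)
  also have "\<dots> = (\<Sum>i<j. real (j choose Suc (j - Suc i)) * (deriv ^^ Suc (j - Suc i)) f (fst J) * fst (snd J (Suc i)))"
    by (rule sum.cong) (auto simp: Suc_diff_Suc binomial_symmetric[symmetric] simp del: funpow.simps)
  \<comment> \<open>the new term \<open>m = 0\<close> has the binomial coefficient of \<open>Suc j\<close> over \<open>j\<close>, which is zero\<close>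
  also have "\<dots> = (\<Sum>m\<le>j. real (j choose Suc (j - m)) * (deriv ^^ Suc (j - m)) f (fst J) * fst (snd J m))"
    by (subst sum.atMost_shift) simp
  finally have 1: "leibniz_sum j f 1 J - f (fst J) * fst (snd J (Suc j)) = \<dots>" .
  have 2: "leibniz_sum j g 0 J = (\<Sum>m\<le>j. real (j choose (j - m)) * (deriv ^^ (j - m)) g (fst J) * fst (snd J m))"
    unfolding leibniz_sum_def by (rule sum.cong) (auto simp: binomial_symmetric[symmetric])
  show ?thesis
    unfolding 1 unfolding 2 weight_def sum_subtractf[symmetric] 
    by (rule sum.cong) (auto simp: algebra_simps simp del: funpow.simps)
qed

lemma sum_triangle_swap:
  fixes F :: "nat \<Rightarrow> nat \<Rightarrow> 'a::comm_monoid_add"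
  shows "(\<Sum>k\<le>n. \<Sum>m\<le>k. F k m) = (\<Sum>m\<le>n. \<Sum>j\<le>n - m. F (m + j) m)"
proof (induction n)
  case (Suc n)
  have "(\<Sum>m\<le>Suc n. \<Sum>j\<le>Suc n - m. F (m + j) m)
      = (\<Sum>m\<le>n. (\<Sum>j\<le>n - m. F (m + j) m) + F (Suc n) m) + F (Suc n) (Suc n)"
    by (simp add: Suc_diff_le)
  then show ?case
    by (simp add: Suc sum.distrib add.assoc)
qed simp

lemma coef_CARD [simp]: "coef (c :: real ^ 'n) CARD('n) = 1"
  by (simp add: coef_def)

lemma Delta_eq: "Delta (J :: 'n::finite jet) = (\<Sum>k\<le>CARD('n). coef (snd (snd J 0)) k * fst (snd J k))"
  by (simp add: Delta_def case_prod_beta flip: lessThan_Suc_atMost)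

text \<open>\<open>\<Phi>\<^sub>m\<close> is made to cancel the factor of \<open>y\<^sup>(\<^sup>m\<^sup>)\<close> in \<open>\<Sum>c\<^sub>k \<zeta>\<^sup>(\<^sup>k\<^sup>)\<close> up to the multiple \<open>g - n f'\<close> of \<open>c\<^sub>m\<close>.
  That multiple is the same for all \<open>m\<close>, and it is also the factor of \<open>y\<^sup>(\<^sup>n\<^sup>)\<close>, so what remains is
  \<open>(g - n f') \<Delta>\<close>. The term at \<open>m = 0\<close>, multiplied by \<open>y\<close>, absorbs the inhomogeneous part \<open>\<Sum>c\<^sub>k h\<^sup>(\<^sup>k\<^sup>)\<close>.\<close>

lemma weight_sum_Phi:
  fixes c :: "real ^ 'n::finite"
  assumes "m < CARD('n)"
  shows "(\<Sum>j\<le>CARD('n) - m. coef c (m + j) * weight f g x (m + j) j) + Phi f g h x y c m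
    = coef c m * (g x - real CARD('n) * deriv f x)
      - (if m = 0 then (\<Sum>k\<le>CARD('n). coef c k * (deriv ^^ k) h x) / y else 0)"
proof -
  have split: "(\<Sum>j\<le>N. F j) = F 0 + (\<Sum>j=1..N. F j)" for N and F :: "nat \<Rightarrow> real"
    by (simp add: sum.atLeast_Suc_atMost atMost_atLeast0)
  have A: "(\<Sum>j\<le>CARD('n) - m. coef c (m + j) * weight f g x (m + j) j)
     = coef c m * (g x - real m * deriv f x)
      - (\<Sum>j=1..CARD('n) - m. coef c (m + j) *
          (real ((m + j) choose (j + 1)) * (deriv ^^ (j + 1)) f x
           - real ((m + j) choose j) * (deriv ^^ j) g x))"
    unfolding split sum_negf[symmetric] diff_conv_add_uminus[of "coef c m * _"]
    by (intro arg_cong2[of _ _ _ _ "(+)"] sum.cong) (simp_all add: weight_def algebra_simps)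
  have H: "(\<Sum>k\<le>CARD('n). coef c k * (deriv ^^ k) h x) / y
      = coef c 0 * (h x / y) + (\<Sum>j=1..CARD('n). coef c j * real (j choose j) * ((deriv ^^ j) h x / y))"
    unfolding split by (simp add: add_divide_distrib sum_divide_distrib)
  have "real (CARD('n) - m) = real CARD('n) - real m"
    using assms by (simp add: of_nat_diff)
  then show ?thesis
    unfolding A H Phi_def by (simp add: algebra_simps)
qed

text \<open>This identity holds off the solution set and serves both directions. If the \<open>c\<close>-components are
  the \<open>\<Phi>\<^sub>m\<close>, the prolongation is a multiple of \<open>\<Delta>\<close>. Conversely, on \<open>\<Delta> = 0\<close> it is a linear form in
  \<open>y, y', \<dots>, y\<^sup>(\<^sup>n\<^sup>-\<^sup>1\<^sup>)\<close> whose coefficients measure the deviation from the \<open>\<Phi>\<^sub>m\<close>.\<close>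

lemma prolong_Delta_affine_field:
  fixes X :: "'n::finite pt \<Rightarrow> 'n pt"
  assumes "open U" "smooth_on U X"
    and fgh: "smooth_on (fst ` U) f" "smooth_on (fst ` U) g" "smooth_on (fst ` U) h"
    and xi: "\<And>p. p \<in> U \<Longrightarrow> fst (X p) = f (fst p)"
    and eta: "\<And>p. p \<in> U \<Longrightarrow> fst (snd (X p)) = fst (snd p) * g (fst p) + h (fst p)"
    and J: "base (x, u) \<in> U" "fst (u 0) \<noteq> 0"
  shows "prolong CARD('n) X Delta (x, u)
    = (\<Sum>m<CARD('n). (coef (snd (snd (X (base (x, u))))) m - Phi f g h x (fst (u 0)) (snd (u 0)) m) * fst (u m))
      + (g x - real CARD('n) * deriv f x) * Delta (x, u)"
proof -
  define n where "n = CARD('n)"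
  have n: "n > 0" by (simp add: n_def)
  define a where "a = coef (snd (u 0))"
  define Y where "Y m = fst (u m)" for m
  define H where "H = (\<Sum>k\<le>n. a k * (deriv ^^ k) h x)"
  define A where "A m = (\<Sum>j\<le>n - m. a (m + j) * weight f g x (m + j) j)" for m
  have an: "a n = 1" by (simp add: a_def n_def)
  have Z: "y_coeff X k (x, u) = (deriv ^^ k) h x + (\<Sum>m\<le>k. Y m * weight f g x k (k - m))" for k
    using y_coeff_affine_field[OF assms(1,2) fgh xi eta J(1), of k] leibniz_sum_weight[of k g "(x, u)" f]
    by (simp add: Y_def)
  have "(\<Sum>k\<le>n. a k * y_coeff X k (x, u)) = H + (\<Sum>k\<le>n. \<Sum>m\<le>k. a k * (Y m * weight f g x k (k - m)))"
    by (simp add: Z H_def ring_distribs sum.distrib sum_distrib_left)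
  also have "\<dots> = H + (\<Sum>m\<le>n. Y m * A m)"
    unfolding sum_triangle_swap by (simp add: A_def sum_distrib_left mult_ac)
  also have "\<dots> = H + (\<Sum>m<n. Y m * A m) + Y n * (g x - real n * deriv f x)"
    by (simp add: A_def an weight_def flip: lessThan_Suc_atMost)
  also have "(\<Sum>m<n. Y m * A m) = (\<Sum>m<n. a m * (g x - real n * deriv f x) * Y m
      - Phi f g h x (Y 0) (snd (u 0)) m * Y m - (if m = 0 then H else 0))"
  proof (rule sum.cong)
    fix m assume "m \<in> {..<n}"
    then have "A m + Phi f g h x (Y 0) (snd (u 0)) m = a m * (g x - real n * deriv f x) - (if m = 0 then H / Y 0 else 0)"
      using weight_sum_Phi[of m "snd (u 0)" f g x h "Y 0"] unfolding A_def a_def n_def H_def by simp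
    then have A_m: "A m = a m * (g x - real n * deriv f x) - (if m = 0 then H / Y 0 else 0)
        - Phi f g h x (Y 0) (snd (u 0)) m"
      by linarith
    show "Y m * A m = a m * (g x - real n * deriv f x) * Y m
        - Phi f g h x (Y 0) (snd (u 0)) m * Y m - (if m = 0 then H else 0)"
      unfolding A_m using J(2) by (cases "m = 0") (auto simp: Y_def algebra_simps)
  qed simp
  also have "\<dots> = (g x - real n * deriv f x) * (\<Sum>m<n. a m * Y m)
      - (\<Sum>m<n. Phi f g h x (Y 0) (snd (u 0)) m * Y m) - H"
    using n by (simp add: sum_subtractf sum_distrib_left mult_ac sum.delta)
  finally have *: "(\<Sum>k\<le>n. a k * y_coeff X k (x, u)) = (g x - real n * deriv f x) * (\<Sum>m\<le>n. a m * Y m)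
      - (\<Sum>m<n. Phi f g h x (Y 0) (snd (u 0)) m * Y m)"
    by (simp add: an algebra_simps flip: lessThan_Suc_atMost)
  have "prolong n X Delta (x, u) = (\<Sum>k\<le>n. a k * y_coeff X k (x, u))
      + (\<Sum>k<n. coef (snd (snd (X (base (x, u))))) k * Y k)"
    using prolong_Delta[OF assms(1,2) J(1)] an
    by (simp add: n_def a_def Y_def flip: lessThan_Suc_atMost)
  also have "\<dots> = (\<Sum>m<n. (coef (snd (snd (X (base (x, u))))) m - Phi f g h x (Y 0) (snd (u 0)) m) * Y m)
      + (g x - real n * deriv f x) * (\<Sum>m\<le>n. a m * Y m)"
    unfolding * by (simp add: left_diff_distrib sum_subtractf)
  finally show ?thesis
    by (simp add: Delta_eq n_def a_def Y_def)
qed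

lemma smooth_on_compose_fst:
  fixes f :: "real \<Rightarrow> real"
  assumes "open U" "smooth_on (fst ` U) f"
  shows "smooth_on U (\<lambda>p. (deriv ^^ j) f (fst p))"
  using smooth_on_deriv_iterate[OF open_image_fst[OF assms(1)] assms(2)]
  by (rule smooth_on_compose_real[OF assms(1) _ smooth_on_fst[OF assms(1) smooth_on_id[OF assms(1)]]]) auto

lemma smooth_on_coef_vec:
  fixes a :: "nat \<Rightarrow> 'a::real_normed_vector \<Rightarrow> real"
  assumes "open S" "\<And>k. smooth_on S (a k)"
  shows "smooth_on S (\<lambda>p. coef_vec (\<lambda>k. a k p) :: real ^ 'n::finite)"
proof (rule smooth_on_componentwise[OF assms(1)])
  fix b :: "real ^ 'n" assume "b \<in> Basis"
  then obtain i where "b = axis i 1" by (auto simp: Basis_vec_def)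
  then show "smooth_on S (\<lambda>p. coef_vec (\<lambda>k. a k p) \<bullet> b)"
    using assms(2) by (simp add: inner_axis coef_vec_def)
qed

lemma smooth_on_coef:
  assumes "open S" "smooth_on S (F :: 'a::real_normed_vector \<Rightarrow> real ^ 'n::finite)"
  shows "smooth_on S (\<lambda>p. coef (F p) k)"
  unfolding coef_def using assms
  by (cases "k = CARD('n)") (auto intro: smooth_on_const smooth_on_linear[OF _ bounded_linear_vec_nth])

lemma smooth_on_X_S:
  fixes U :: "'n::finite pt set"
  assumes U: "open U" "\<And>x y c. (x, y, c) \<in> U \<Longrightarrow> y \<noteq> 0"
    and fgh: "smooth_on (fst ` U) f" "smooth_on (fst ` U) g" "smooth_on (fst ` U) h"
  shows "smooth_on U (X_S f g h)"
proof -
  have d: "smooth_on U (\<lambda>p. (deriv ^^ j) a (fst p))" if "smooth_on (fst ` U) a" for a j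
    using smooth_on_compose_fst[OF U(1) that] .
  have d0: "smooth_on U (\<lambda>p. a (fst p))" "smooth_on U (\<lambda>p. deriv a (fst p))" if "smooth_on (fst ` U) a" for a
    using d[OF that, of 0] d[OF that, of 1] by simp_all
  have "smooth_on U (\<lambda>p. Phi f g h (fst p) (fst (snd p)) (snd (snd p)) k)" for k
    unfolding Phi_def
    by (intro smooth_on_add smooth_on_mult smooth_on_diff smooth_on_sum smooth_on_const smooth_on_minus
        smooth_on_divide smooth_on_coef smooth_on_snd smooth_on_fst smooth_on_id d d0 fgh U(1))
      (use U(2) in auto)
  then have "smooth_on U (\<lambda>p. (f (fst p), fst (snd p) * g (fst p) + h (fst p),
      coef_vec (\<lambda>k. Phi f g h (fst p) (fst (snd p)) (snd (snd p)) k) :: real ^ 'n))"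
    by (intro smooth_on_Pair smooth_on_coef_vec smooth_on_add smooth_on_mult smooth_on_fst smooth_on_snd
        smooth_on_id d0 fgh U(1))
  then show ?thesis
    by (rule smooth_on_cong[OF U(1), rotated]) (auto simp: X_S_def)
qed

lemma GS_generator_X_S:
  fixes U :: "'n::finite pt set"
  assumes U: "open U" "\<And>x y c. (x, y, c) \<in> U \<Longrightarrow> y \<noteq> 0"
    and fgh: "smooth_on (fst ` U) f" "smooth_on (fst ` U) g" "smooth_on (fst ` U) h"
  shows "GS_generator U (X_S f g h)"
proof -
  have smooth: "smooth_on U (X_S f g h)"
    by (rule smooth_on_X_S[OF U(1) _ fgh]) (use U(2) in auto)
  have "prolong CARD('n) (X_S f g h) Delta J = 0" if J: "base J \<in> U" "Delta J = 0" for J :: "'n jet"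
  proof -
    obtain x u where [simp]: "J = (x, u)" by (cases J)
    have y: "fst (u 0) \<noteq> 0" using U(2)[of x "fst (u 0)" "snd (u 0)"] J(1) by (simp add: base_def)
    have "coef (snd (snd (X_S f g h (base J)))) m = Phi f g h x (fst (u 0)) (snd (u 0)) m" if "m < CARD('n)" for m
      using that by (simp add: X_S_def base_def case_prod_beta coef_coef_vec)
    then show ?thesis
      using prolong_Delta_affine_field[OF U(1) smooth fgh, of x u] J y
      by (simp add: X_S_def case_prod_beta)
  qed
  then show ?thesis
    using smooth by (simp add: GS_generator_def)
qed

text \<open>The derivatives \<open>y', \<dots>, y\<^sup>(\<^sup>n\<^sup>-\<^sup>1\<^sup>)\<close> are free on the solution set, since \<open>y\<^sup>(\<^sup>n\<^sup>)\<close> can be solved for, and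
  \<open>y\<close> itself does not vanish. Hence the linear form in them has zero coefficients.\<close>

lemma GS_generator_affine_field_unique:
  fixes U :: "'n::finite pt set"
  assumes U: "open U" "\<And>x y c. (x, y, c) \<in> U \<Longrightarrow> y \<noteq> 0"
    and fgh: "smooth_on (fst ` U) f" "smooth_on (fst ` U) g" "smooth_on (fst ` U) h"
    and X: "GS_generator U X"
    and xi: "\<And>p. p \<in> U \<Longrightarrow> fst (X p) = f (fst p)"
    and eta: "\<And>p. p \<in> U \<Longrightarrow> fst (snd (X p)) = fst (snd p) * g (fst p) + h (fst p)"
    and p: "p \<in> U"
  shows "X p = X_S f g h p"
proof -
  obtain x y c where [simp]: "p = (x, y, c)" by (cases p)
  have y: "y \<noteq> 0" using U(2) p by auto
  define \<phi> where "\<phi> = snd (snd (X p))"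
  define R where "R m = coef \<phi> m - Phi f g h x y c m" for m
  have key: "(\<Sum>m<CARD('n). R m * Y m) = 0" if "Y 0 = y" for Y
  proof -
    \<comment> \<open>the jet with \<open>y\<close>-derivatives \<open>Y\<close> below order \<open>n\<close> that satisfies the equation\<close>
    define v where "v i = (if i = CARD('n) then - (\<Sum>k<CARD('n). coef c k * Y k) else Y i)" for i
    define u where "u i = (v i, c)" for i :: nat
    have J: "base (x, u) = p" using that by (simp add: base_def u_def v_def)
    have D: "Delta (x, u) = 0"
      by (simp add: Delta_def u_def v_def)
    have "prolong CARD('n) X Delta (x, u) = 0"
      using X J D p by (simp add: GS_generator_def)
    moreover have "u 0 = (y, c)" using that by (simp add: u_def v_def)
    ultimately have "(\<Sum>m<CARD('n). R m * fst (u m)) = 0"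
      using prolong_Delta_affine_field[OF U(1) _ fgh xi eta, where x = x and u = u] X J p y D
      by (simp add: GS_generator_def R_def \<phi>_def)
    then show ?thesis by (simp add: u_def v_def)
  qed
  have R0: "R 0 = 0"
    using key[of "\<lambda>m. if m = 0 then y else 0"] y by (simp add: if_distrib[of "(*) _"] cong: if_cong)
  have R: "R m = 0" if "m < CARD('n)" for m
  proof (cases "m = 0")
    case False
    have "(\<Sum>k<CARD('n). R k * (if k = 0 then y else if k = m then 1 else 0)) = R m"
      (is "sum ?F _ = _")
    proof -
      have F: "?F = (\<lambda>k. if k = m then R m else 0)" using False R0 by auto
      show ?thesis unfolding F using that by simp
    qed
    then show ?thesis using key[of "\<lambda>k. if k = 0 then y else if k = m then 1 else 0"] by simp
  qed (simp add: R0)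
  have "coef_vec (Phi f g h x y c) = (coef_vec (coef \<phi>) :: real ^ 'n)"
  proof -
    have "to_nat_on UNIV i < CARD('n)" for i :: 'n
      using to_nat_on_finite[of "UNIV :: 'n set"] by (auto simp: bij_betw_def)
    then show ?thesis using R by (simp add: coef_vec_def vec_eq_iff R_def)
  qed
  then show ?thesis
    using xi[OF p] eta[OF p] by (simp add: X_S_def coef_vec_coef \<phi>_def prod_eq_iff)
qed

section \<open>Functions that are constant on fibres\<close>

lemma has_derivative_along_line:
  assumes "smooth_on U F" "p + t *\<^sub>R v \<in> U"
  shows "((\<lambda>t. F (p + t *\<^sub>R v)) has_vector_derivative frechet_derivative F (at (p + t *\<^sub>R v)) v) (at t)"
proof -
  have "((\<lambda>t. p + t *\<^sub>R v) has_derivative (\<lambda>t. t *\<^sub>R v)) (at t)"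
    by (auto intro!: derivative_eq_intros)
  from has_derivative_compose[OF this smooth_on_has_derivative[OF assms]]
  show ?thesis
    by (simp add: has_vector_derivative_def
        linear_scale[OF has_derivative_linear[OF smooth_on_has_derivative[OF assms]]])
qed

lemma constant_along_segment:
  assumes "smooth_on U F" "\<And>q. q \<in> U \<Longrightarrow> frechet_derivative F (at q) v = 0"
    and "\<And>t. t \<in> {0..1} \<Longrightarrow> p + t *\<^sub>R v \<in> U"
  shows "F (p + v) = F p"
proof -
  have "\<exists>c. \<forall>t\<in>{0..1}. F (p + t *\<^sub>R v) = c"
  proof (rule has_derivative_zero_constant)
    fix t :: real assume t: "t \<in> {0..1}"
    show "((\<lambda>t. F (p + t *\<^sub>R v)) has_derivative (\<lambda>h. 0)) (at t within {0..1})"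
      using has_derivative_along_line[OF assms(1) assms(3)[OF t]] assms(2)[OF assms(3)[OF t]]
      by (simp add: has_vector_derivative_def has_derivative_at_withinI)
  qed simp
  then have "F (p + 1 *\<^sub>R v) = F (p + 0 *\<^sub>R v)" by (metis atLeastAtMost_iff order_refl zero_le_one)
  then show ?thesis by simp
qed

text \<open>If \<open>F\<close> does not change in direction \<open>v\<close>, neither do its derivatives in other directions. Near
  a point \<open>F\<close> is invariant under translation by small multiples of \<open>v\<close>, hence so is its derivative.\<close>

lemma directional_derivative_zero_commute:
  assumes U: "open U" and F: "smooth_on U F" "\<And>q. q \<in> U \<Longrightarrow> frechet_derivative F (at q) v = 0"
    and p: "p \<in> U"
  shows "frechet_derivative (\<lambda>q. frechet_derivative F (at q) w) (at p) v = 0"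
proof -
  obtain e where e: "e > 0" "ball p e \<subseteq> U" using U p by (meson openE)
  have tr: "F (q + t *\<^sub>R v) = F q" if "norm (q - p) < e / 2" "norm (t *\<^sub>R v) < e / 2" for q t
  proof (rule constant_along_segment[OF F(1)])
    show "frechet_derivative F (at q) (t *\<^sub>R v) = 0" if "q \<in> U" for q
      using F(2)[OF that] linear_scale[OF has_derivative_linear[OF smooth_on_has_derivative[OF F(1) that]], of t v]
      by simp
    fix s :: real assume "s \<in> {0..1}"
    then have "norm (s *\<^sub>R t *\<^sub>R v) \<le> norm (t *\<^sub>R v)"
      by (auto simp: abs_mult mult_left_le_one_le intro!: mult_right_mono)
    with that have "norm ((q - p) + s *\<^sub>R t *\<^sub>R v) < e"
      using norm_triangle_ineq[of "q - p" "s *\<^sub>R t *\<^sub>R v"] by linarith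
    moreover have "norm (p - (q + s *\<^sub>R t *\<^sub>R v)) = norm ((q - p) + s *\<^sub>R t *\<^sub>R v)"
      by (subst norm_minus_commute) (simp add: algebra_simps)
    ultimately show "q + s *\<^sub>R t *\<^sub>R v \<in> U"
      using e(2) by (auto simp: dist_norm)
  qed
  let ?G = "\<lambda>q. frechet_derivative F (at q) w"
  have const: "?G (p + t *\<^sub>R v) = ?G p" if t: "norm (t *\<^sub>R v) < e / 2" for t
  proof -
    have "norm (t *\<^sub>R v) < e" using t e(1) by linarith
    then have q: "p + t *\<^sub>R v \<in> U"
      using e by (intro subsetD[OF e(2)]) (simp add: dist_norm)
    have "((\<lambda>q. q + t *\<^sub>R v) has_derivative (\<lambda>h. h)) (at p)"
      by (auto intro!: derivative_eq_intros)
    from has_derivative_compose[OF this smooth_on_has_derivative[OF F(1) q]]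
    have "(F has_derivative frechet_derivative F (at (p + t *\<^sub>R v))) (at p)"
      by (rule has_derivative_transform_within_open[of _ _ _ _ "ball p (e / 2)"])
        (use e tr[OF _ t] in \<open>auto simp: dist_norm norm_minus_commute\<close>)
    then show ?thesis using frechet_derivative_at by metis
  qed
  have ev: "eventually (\<lambda>t. norm (t *\<^sub>R v) < e / 2) (nhds 0)"
  proof -
    have "((\<lambda>t. norm (t *\<^sub>R v)) \<longlongrightarrow> norm (0 *\<^sub>R v)) (nhds 0)"
      by (intro tendsto_intros filterlim_ident)
    then show ?thesis using e(1) by (intro order_tendstoD(2)) auto
  qed
  have "((\<lambda>t. ?G (p + t *\<^sub>R v)) has_vector_derivative frechet_derivative ?G (at p) v) (at 0)"
    using has_derivative_along_line[OF smooth_on_directional[OF F(1), of w], of p 0 v] p by simp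
  moreover have "((\<lambda>t. ?G (p + t *\<^sub>R v)) has_vector_derivative 0) (at 0)"
  proof -
    obtain S where S: "open S" "0 \<in> S" "\<forall>t\<in>S. norm (t *\<^sub>R v) < e / 2"
      using ev unfolding eventually_nhds by blast
    show ?thesis
      by (rule has_vector_derivative_transform_within_open[OF has_vector_derivative_const[of "?G p"] S(1,2)])
        (use S(3) const in auto)
  qed
  ultimately show ?thesis by (rule vector_derivative_unique_at)
qed

text \<open>Connectedness of the fibres over \<open>x\<close> turns local constancy into a function of \<open>x\<close>. The slices
  of a fibre at constant \<open>y\<close> may well be disconnected, so \<open>y\<close> and \<open>c\<close> cannot be treated one after
  the other globally.\<close>

lemma locally_fibrewise_constant:
  fixes F :: "real \<times> 'a::real_normed_vector \<Rightarrow> real"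
  assumes U: "open U" "\<And>x. connected {u. (x, u) \<in> U}"
    and F: "smooth_on U F"
    and loc: "\<And>x u. (x, u) \<in> U \<Longrightarrow> eventually (\<lambda>u'. F (x, u') = F (x, u)) (nhds u)"
  shows "\<exists>f. smooth_on (fst ` U) f \<and> (\<forall>p\<in>U. F p = f (fst p))"
proof -
  define f where "f x = F (x, SOME u. (x, u) \<in> U)" for x
  have eq: "F (x, u) = f x" if "(x, u) \<in> U" for x u
  proof -
    have "(x, SOME u. (x, u) \<in> U) \<in> U" using that by (rule someI)
    moreover have "\<forall>a\<in>{u. (x, u) \<in> U}. eventually (\<lambda>b. F (x, a) = F (x, b)) (at a within {u. (x, u) \<in> U})"
    proof
      fix a assume "a \<in> {u. (x, u) \<in> U}"
      then have "eventually (\<lambda>b. F (x, b) = F (x, a)) (nhds a)" using loc by simp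
      then show "eventually (\<lambda>b. F (x, a) = F (x, b)) (at a within {u. (x, u) \<in> U})"
        unfolding eventually_at_filter by eventually_elim simp
    qed
    ultimately show ?thesis
      unfolding f_def using that by (intro connected_local_const[OF U(2)]) auto
  qed
  then show ?thesis
    using smooth_on_descend[OF U(1) F eq] by auto
qed

lemma fibrewise_constant:
  fixes F :: "real \<times> 'a::real_normed_vector \<Rightarrow> real"
  assumes U: "open U" "\<And>x. connected {u. (x, u) \<in> U}"
    and F: "smooth_on U F" "\<And>p w. p \<in> U \<Longrightarrow> frechet_derivative F (at p) (0, w) = 0"
  shows "\<exists>f. smooth_on (fst ` U) f \<and> (\<forall>p\<in>U. F p = f (fst p))"
proof (rule locally_fibrewise_constant[OF U F(1)])
  fix x u assume xu: "(x, u) \<in> U"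
  obtain A B where AB: "open A" "open B" "(x, u) \<in> A \<times> B" "A \<times> B \<subseteq> U"
    using open_prod_elim[OF U(1) xu] by metis
  then have "u \<in> B" by simp
  then obtain e where e: "e > 0" "ball u e \<subseteq> B" using openE[OF \<open>open B\<close>] by metis
  have "F (x, u') = F (x, u)" if "u' \<in> ball u e" for u'
  proof -
    have "F ((x, u) + (0, u' - u)) = F (x, u)"
    proof (rule constant_along_segment[OF F(1) F(2)])
      fix t :: real assume "t \<in> {0..1}"
      then have "u + t *\<^sub>R (u' - u) \<in> ball u e"
        using that by (auto simp: dist_norm norm_minus_commute intro: le_less_trans[OF mult_left_le_one_le])
      then show "(x, u) + t *\<^sub>R (0, u' - u) \<in> U" using e AB by auto
    qed auto
    then show ?thesis by simp
  qed
  moreover have "eventually (\<lambda>u'. u' \<in> ball u e) (nhds u)"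
    using e(1) by (intro eventually_nhds_in_open) auto
  ultimately show "eventually (\<lambda>u'. F (x, u') = F (x, u)) (nhds u)"
    by (rule eventually_mono[rotated])
qed

section \<open>Determining equations\<close>

lemma frechet_split:
  assumes "smooth_on U F" "p \<in> U"
  shows "frechet_derivative F (at p) (v + t *\<^sub>R w) = frechet_derivative F (at p) v + t *\<^sub>R frechet_derivative F (at p) w"
  using has_derivative_linear[OF smooth_on_has_derivative[OF assms]] by (simp add: linear_add linear_scale)

definition bump :: "nat \<Rightarrow> real \<times> (real ^ 'n::finite) \<Rightarrow> 'n jet" where
  "bump j w = (0, \<lambda>i. if i = j then w else 0)"

lemma bump_simps [simp]: "fst (bump j w) = 0" "snd (bump j w) i = (if i = j then w else 0)"
  by (simp_all add: bump_def)

lemma base_line_bump [simp]: "j \<noteq> 0 \<Longrightarrow> base (line J (bump j w) t) = base J"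
  by (simp add: base_def)

lemma base_shift_jet [simp]: "base (shift_jet J) = (1, snd J (Suc 0))"
  by (simp add: base_def)

text \<open>The rate at which \<open>\<zeta>\<^sup>(\<^sup>j\<^sup>)\<close> changes when its highest jet coordinate \<open>u\<^sub>j\<close> moves in direction \<open>w\<close>. For
  \<open>j \<ge> 2\<close> it does not depend on \<open>u\<^sub>j\<close>, so \<open>\<zeta>\<^sup>(\<^sup>j\<^sup>)\<close> is affine in \<open>u\<^sub>j\<close>.\<close>

definition top_coeff :: "('n::finite pt \<Rightarrow> 'n pt) \<Rightarrow> nat \<Rightarrow> 'n jet \<Rightarrow> real \<times> (real ^ 'n) \<Rightarrow> real" where
  "top_coeff X j J w =
     frechet_derivative (\<lambda>p. fst (snd (X p))) (at (base J)) (0, w)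
     - fst (snd J 1) * frechet_derivative (\<lambda>p. fst (X p)) (at (base J)) (0, w)
     - real j * fst w * frechet_derivative (\<lambda>p. fst (X p)) (at (base J)) (1, snd J 1)"

context
  fixes U :: "'n::finite pt set" and X :: "'n pt \<Rightarrow> 'n pt"
  assumes U: "open U" and smooth_X: "smooth_on U X"
begin

abbreviation (input) "xi p \<equiv> fst (X p)"
abbreviation (input) "eta p \<equiv> fst (snd (X p))"
abbreviation (input) "dxi p \<equiv> frechet_derivative (\<lambda>p. fst (X p)) (at p)"
abbreviation (input) "deta p \<equiv> frechet_derivative (\<lambda>p. fst (snd (X p))) (at p)"

lemma smooth_xi: "smooth_on U (\<lambda>p. fst (X p))" and smooth_eta: "smooth_on U (\<lambda>p. fst (snd (X p)))"
  using U smooth_X by (auto intro: smooth_intros)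

lemma y_coeff_1:
  assumes "base J \<in> U"
  shows "y_coeff X (Suc 0) J = deta (base J) (1, snd J 1) - fst (snd J 1) * dxi (base J) (1, snd J 1)"
  using y_coeff_Suc[OF U smooth_X assms, of 0] along_base[OF smooth_eta assms] along_base[OF smooth_xi assms]
  by (simp add: mult.commute)

text \<open>In \<open>\<zeta>\<^sup>(\<^sup>j\<^sup>+\<^sup>1\<^sup>) = D \<zeta>\<^sup>(\<^sup>j\<^sup>) - y\<^sup>(\<^sup>j\<^sup>+\<^sup>1\<^sup>) D\<xi>\<close> the coordinate \<open>u\<^bsub>j+1\<^esub>\<close> enters the first term only as the
  \<open>j\<close>-th component of the direction of differentiation, so linearity in the direction applies.
  The second term adds one more copy of \<open>D\<xi>\<close>.\<close>

lemma y_coeff_top_order_step: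
  assumes J: "base J \<in> U" and j: "j \<ge> 1"
    and IH: "along (y_coeff X j) J (bump j w) = top_coeff X j J w"
  shows "y_coeff X (Suc j) (line J (bump (Suc j) w) t) = y_coeff X (Suc j) J + t * top_coeff X (Suc j) J w"
proof -
  let ?J = "line J (bump (Suc j) w) t"
  have b: "base ?J = base J" "snd ?J (Suc 0) = snd J (Suc 0)" using j by auto
  have "along (y_coeff X j) ?J (shift_jet ?J) = along (y_coeff X j) J (shift_jet ?J)"
  proof -
    have "y_coeff X j (line ?J V s) = y_coeff X j (line J V s)" for V s
      by (rule arg_cong[OF prolong_coeff_order]) auto
    then show ?thesis by (simp add: along_line)
  qed
  also have "\<dots> = along (y_coeff X j) J (line (shift_jet J) (bump j w) t)"
    by (rule arg_cong[of _ _ "along (y_coeff X j) J"]) (auto simp: prod_eq_iff)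
  also have "\<dots> = along (y_coeff X j) J (shift_jet J) + t * top_coeff X j J w"
    using along_linear[OF diff_fun_y_coeff[OF U smooth_X] U J] IH by simp
  finally have 1: "along (y_coeff X j) ?J (shift_jet ?J) = along (y_coeff X j) J (shift_jet J) + t * top_coeff X j J w" .
  have 2: "along (\<lambda>J. fst (X (base J))) ?J (shift_jet ?J) = dxi (base J) (1, snd J 1)"
    "along (\<lambda>J. fst (X (base J))) J (shift_jet J) = dxi (base J) (1, snd J 1)"
    using along_base[OF smooth_xi, of ?J "shift_jet ?J"] along_base[OF smooth_xi J, of "shift_jet J"] J b
    by (simp_all del: snd_line)
  have "y_coeff X (Suc j) ?J = along (y_coeff X j) ?J (shift_jet ?J)
      - along (\<lambda>J. fst (X (base J))) ?J (shift_jet ?J) * fst (snd ?J (Suc j))"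
    using J b by (intro y_coeff_Suc[OF U smooth_X]) simp
  also have "\<dots> = y_coeff X (Suc j) J + t * top_coeff X (Suc j) J w"
    unfolding 1 2 y_coeff_Suc[OF U smooth_X J] by (simp add: top_coeff_def algebra_simps)
  finally show ?thesis .
qed

lemma along_y_coeff_top_order:
  assumes J: "base J \<in> U" and j: "j \<ge> 1"
  shows "along (y_coeff X j) J (bump j w) = top_coeff X j J w"
  using j
proof (induction j rule: dec_induct)
  case base
  have split: "(1, snd J (Suc 0) + t *\<^sub>R w) = (1, snd J (Suc 0)) + t *\<^sub>R (0, w)" for t :: real
    by simp
  have "y_coeff X (Suc 0) (line J (bump (Suc 0) w) t) = deta (base J) (1, snd J 1) + t * deta (base J) (0, w)
      - (fst (snd J 1) + t * fst w) * (dxi (base J) (1, snd J 1) + t * dxi (base J) (0, w))" for t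
    using y_coeff_1[of "line J (bump (Suc 0) w) t"] J
    by (simp add: split frechet_split[OF smooth_eta J] frechet_split[OF smooth_xi J] del: add_Pair scaleR_Pair)
  then show ?case
    by (intro along_unique)
      (auto simp: top_coeff_def has_real_derivative_iff_has_vector_derivative[symmetric] simp del: prolong_coeff.simps
        intro!: derivative_eq_intros)
next
  case (step j)
  have "((\<lambda>t. y_coeff X (Suc j) J + t * top_coeff X (Suc j) J w) has_vector_derivative top_coeff X (Suc j) J w) (at 0)"
    by (auto simp: has_real_derivative_iff_has_vector_derivative[symmetric] intro!: derivative_eq_intros)
  then show ?case
    using y_coeff_top_order_step[OF J step.hyps(1) step.IH] by (intro along_unique) (simp del: prolong_coeff.simps)
qed

lemma y_coeff_top_order:
  assumes "base J \<in> U" "j \<ge> 2"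
  shows "y_coeff X j (line J (bump j w) t) = y_coeff X j J + t * top_coeff X j J w"
proof -
  obtain i where "j = Suc i" "i \<ge> 1" using assms(2) by (cases j) auto
  then show ?thesis
    using y_coeff_top_order_step[OF assms(1) _ along_y_coeff_top_order[OF assms(1)]] by blast
qed

text \<open>If \<open>\<xi>\<close> and \<open>\<eta>\<close> do not involve \<open>c\<close>, their prolongation to the \<open>y\<close>-derivatives does not see the
  \<open>c\<close>-part of a jet at all.\<close>

lemma y_coeff_coefficient_free:
  assumes ind: "\<And>x y c c'. (x, y, c) \<in> U \<Longrightarrow> (x, y, c') \<in> U \<Longrightarrow>
      xi (x, y, c) = xi (x, y, c') \<and> eta (x, y, c) = eta (x, y, c')"
    and J: "base J \<in> U" "base J' \<in> U" "fst J = fst J'" "\<And>i. fst (snd J i) = fst (snd J' i)"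
  shows "y_coeff X j J = y_coeff X j J'"
  using J
proof (induction j arbitrary: J J')
  case 0
  show ?case
  proof -
    have eqs: "base J = (fst J, fst (snd J 0), snd (snd J 0))" "base J' = (fst J, fst (snd J 0), snd (snd J' 0))"
      using 0 by (simp_all add: base_def prod_eq_iff)
    from ind[OF 0(1)[unfolded eqs] 0(2)[unfolded eqs]] show ?thesis
      by (simp add: eqs)
  qed
next
  case (Suc j)
  let ?L = "\<lambda>t. line J (shift_jet J) t" and ?L' = "\<lambda>t. line J' (shift_jet J') t"
  have ev: "\<forall>\<^sub>F t in nhds 0. base (?L t) \<in> U \<and> base (?L' t) \<in> U"
    using eventually_base_line[OF U Suc.prems(1)] eventually_base_line[OF U Suc.prems(2)] by (rule eventually_conj)
  have "along (y_coeff X j) J (shift_jet J) = along (y_coeff X j) J' (shift_jet J')"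
    unfolding along_line
  proof (rule vector_derivative_cong_eq)
    show "\<forall>\<^sub>F t in nhds 0. t \<in> UNIV \<longrightarrow> y_coeff X j (?L t) = y_coeff X j (?L' t)"
      using ev by eventually_elim (use Suc.prems in \<open>auto intro!: Suc.IH\<close>)
  qed auto
  moreover have "along (\<lambda>J. fst (X (base J))) J (shift_jet J) = along (\<lambda>J. fst (X (base J))) J' (shift_jet J')"
    unfolding along_line
  proof (rule vector_derivative_cong_eq)
    show "\<forall>\<^sub>F t in nhds 0. t \<in> UNIV \<longrightarrow> xi (base (?L t)) = xi (base (?L' t))"
      using ev
    proof eventually_elim
      case (elim t)
      have "base (?L t) = (fst (?L t), fst (snd (?L t) 0), snd (snd (?L t) 0))"
        "base (?L' t) = (fst (?L t), fst (snd (?L t) 0), snd (snd (?L' t) 0))"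
        using Suc.prems by (simp_all add: base_def prod_eq_iff)
      then show ?case using elim ind by metis
    qed
  qed auto
  ultimately show ?case
    by (simp add: y_coeff_Suc[OF U smooth_X] Suc.prems del: prolong_coeff.simps)
qed

end

text \<open>All derivatives of \<open>y\<close> except \<open>y' = s\<close> and \<open>y\<^sup>(\<^sup>n\<^sup>) = r\<close> vanish, and so do those of \<open>c\<close>. These jets
  already force \<open>\<xi>\<close> and \<open>\<eta>\<close> into the required shape. For \<open>n \<ge> 2\<close>, \<open>s\<close> is free on the solution
  set, and \<open>r\<close> is determined by it.\<close>

definition test_jet :: "'n::finite pt \<Rightarrow> real \<Rightarrow> real \<Rightarrow> 'n jet" where
  "test_jet p s r = (fst p, \<lambda>i. if i = 0 then snd p else if i = 1 then (s, 0)
     else if i = CARD('n) then (r, 0) else 0)"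

lemma base_test_jet [simp]: "base (test_jet p s r) = p"
  by (simp add: base_def test_jet_def)

lemma snd_test_jet [simp]:
  "snd (test_jet p s r) 0 = snd p" "snd (test_jet p s r) (Suc 0) = (s, 0)"
  by (simp_all add: test_jet_def)

lemma sum_first_two:
  fixes F :: "nat \<Rightarrow> real"
  assumes "n \<ge> 2" "\<And>k. k \<ge> 2 \<Longrightarrow> k < n \<Longrightarrow> F k = 0"
  shows "(\<Sum>k<n. F k) = F 0 + F 1"
proof -
  have "(\<Sum>k<n. F k) = (\<Sum>k\<in>{0, 1}. F k)"
    using assms by (intro sum.mono_neutral_right) (auto simp: numeral_2_eq_2 Suc_le_eq)
  then show ?thesis by simp
qed

lemma Delta_test_jet:
  fixes p :: "'n::finite pt"
  assumes "CARD('n) \<ge> 2"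
  shows "Delta (test_jet p s r) = r + (coef (snd (snd p)) 0 * fst (snd p) + coef (snd (snd p)) 1 * s)"
  using assms by (simp add: Delta_def case_prod_beta test_jet_def sum_first_two)

lemma GS_generatorD:
  assumes "GS_generator U X"
  shows "smooth_on U X" "\<And>J :: 'n::finite jet. base J \<in> U \<Longrightarrow> Delta J = 0 \<Longrightarrow> prolong CARD('n) X Delta J = 0"
  using assms unfolding GS_generator_def by blast+

text \<open>The derivative \<open>c\<^sup>(\<^sup>n\<^sup>)\<close> does not occur in \<open>\<Delta>\<close>, and it occurs in the symmetry condition only through
  \<open>\<zeta>\<^sup>(\<^sup>n\<^sup>)\<close>, with factor \<open>\<eta>\<^sub>c - y' \<xi>\<^sub>c\<close>. Since \<open>n \<ge> 2\<close>, \<open>y'\<close> is free, and its values 0 and 1 give \<open>\<eta>\<^sub>c = 0\<close>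
  and \<open>\<xi>\<^sub>c = 0\<close>.\<close>

lemma GS_generator_coefficient_free:
  fixes U :: "'n::finite pt set"
  assumes n: "CARD('n) \<ge> 2" and U: "open U" and X: "GS_generator U X" and p: "p \<in> U"
  shows "frechet_derivative (\<lambda>p. fst (X p)) (at p) (0, 0, v) = 0"
    and "frechet_derivative (\<lambda>p. fst (snd (X p))) (at p) (0, 0, v) = 0"
proof -
  have sX: "smooth_on U X" using X by (simp add: GS_generator_def)
  let ?n = "CARD('n)"
  have *: "top_coeff X ?n (test_jet p s r) (0, v) = 0"
    if "r = - (coef (snd (snd p)) 0 * fst (snd p) + coef (snd (snd p)) 1 * s)" for s r
  proof -
    let ?J = "test_jet p s r" let ?J' = "line ?J (bump ?n (0, v)) 1"
    have D: "Delta ?J = 0" by (simp add: Delta_test_jet[OF n] that)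
    have D': "Delta ?J' = Delta ?J" using n by (simp add: Delta_def case_prod_beta)
    have b: "base ?J' = p" "snd ?J' 0 = snd p" using n by simp_all
    have "y_coeff X k ?J' = y_coeff X k ?J" if "k < ?n" for k
      using that by (intro arg_cong[OF prolong_coeff_order]) auto
    moreover have "prolong ?n X Delta ?J = 0" "prolong ?n X Delta ?J' = 0"
      using GS_generatorD(2)[OF X, of ?J] GS_generatorD(2)[OF X, of ?J'] D D' b p by simp_all
    moreover have "fst (snd ?J' k) = fst (snd ?J k)" for k by simp
    ultimately have "y_coeff X ?n ?J' = y_coeff X ?n ?J"
      using prolong_Delta[OF U sX, of ?J] prolong_Delta[OF U sX, of ?J'] b p by (simp del: snd_line)
    then show ?thesis
      using y_coeff_top_order[OF U sX, of ?J ?n "(0, v)" 1] n p by simp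
  qed
  show "frechet_derivative (\<lambda>p. fst (X p)) (at p) (0, 0, v) = 0"
    "frechet_derivative (\<lambda>p. fst (snd (X p))) (at p) (0, 0, v) = 0"
    using *[OF refl, of 0] *[OF refl, of 1] by (simp_all add: top_coeff_def)
qed

text \<open>A second difference in \<open>y'\<close>. It annihilates affine functions of \<open>y'\<close>, and with them the
  unknown \<open>c\<close>-components of the field.\<close>

definition second_diff :: "('n::finite pt \<Rightarrow> 'n pt) \<Rightarrow> nat \<Rightarrow> 'n pt \<Rightarrow> real" where
  "second_diff X k p = y_coeff X k (test_jet p 1 0) + y_coeff X k (test_jet p (-1) 0)
     - 2 * y_coeff X k (test_jet p 0 0)"

text \<open>The symmetry condition at the values 1, -1 and 0 of \<open>y'\<close>. The additional term is the quadratic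
  part, in \<open>s = y'\<close>, of \<open>y\<^sup>(\<^sup>n\<^sup>) (\<eta>\<^sub>y - n \<xi>\<^sub>x - (n + 1) s \<xi>\<^sub>y)\<close> with \<open>y\<^sup>(\<^sup>n\<^sup>) = - c\<^sub>0 y - c\<^sub>1 s\<close>.\<close>

lemma GS_generator_second_diff:
  fixes U :: "'n::finite pt set"
  assumes n: "CARD('n) \<ge> 2" and U: "open U" and X: "GS_generator U X" and p: "p \<in> U"
  shows "(\<Sum>k\<le>CARD('n). coef (snd (snd p)) k * second_diff X k p)
    + 2 * (real CARD('n) + 1) * coef (snd (snd p)) 1 * frechet_derivative (\<lambda>p. fst (X p)) (at p) (0, 1, 0) = 0"
proof -
  have sX: "smooth_on U X" using X by (simp add: GS_generator_def)
  let ?n = "CARD('n)" let ?c = "coef (snd (snd p))"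
  define ph where "ph = coef (snd (snd (X p)))"
  define Z where "Z k s = y_coeff X k (test_jet p s 0)" for k s
  define dxi where "dxi = frechet_derivative (\<lambda>p. fst (X p)) (at p)"
  define deta where "deta = frechet_derivative (\<lambda>p. fst (snd (X p))) (at p)"
  have xi_split: "dxi (1, s, 0) = dxi (1, 0, 0) + s * dxi (0, 1, 0)" for s
    using frechet_split[OF smooth_xi[OF U sX] p, of "(1, 0, 0)" s "(0, 1, 0)"] by (simp add: dxi_def)
  have E: "(\<Sum>k\<le>?n. ?c k * Z k s) - (?c 0 * fst (snd p) + ?c 1 * s) *
        (deta (0, 1, 0) - s * dxi (0, 1, 0) - real ?n * (dxi (1, 0, 0) + s * dxi (0, 1, 0)))
      + (ph 0 * fst (snd p) + ph 1 * s) = 0" for s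
  proof -
    \<comment> \<open>the value of \<open>y\<^sup>(\<^sup>n\<^sup>)\<close> that puts the test jet on the solution set\<close>
    define r where "r = - (?c 0 * fst (snd p) + ?c 1 * s)"
    let ?J = "test_jet p s r" let ?K = "test_jet p s 0"
    have J: "?J = line ?K (bump ?n (1, 0)) r"
    proof (rule prod_eqI)
      have "?n \<noteq> 0" "?n \<noteq> Suc 0" using n by auto
      then have "snd ?J i = snd (line ?K (bump ?n (1, 0)) r) i" for i
        unfolding test_jet_def snd_line bump_simps
        by (cases "i = ?n") simp_all
      then show "snd ?J = snd (line ?K (bump ?n (1, 0)) r)" ..
    qed (simp add: test_jet_def)
    have low: "y_coeff X k ?J = Z k s" if "k < ?n" for k
      unfolding Z_def using that by (intro arg_cong[OF prolong_coeff_order]) (auto simp: test_jet_def)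
    let ?T = "deta (0, 1, 0) - s * dxi (0, 1, 0) - real ?n * (dxi (1, 0, 0) + s * dxi (0, 1, 0))"
    have "top_coeff X ?n ?K (1, 0) = ?T"
      using xi_split[of s] by (simp add: top_coeff_def dxi_def deta_def)
    then have top: "y_coeff X ?n ?J = Z ?n s + r * ?T"
      unfolding J Z_def using y_coeff_top_order[OF U sX, of ?K ?n "(1, 0)" r] n p by simp
    have ph: "(\<Sum>k<?n. ph k * fst (snd ?J k)) = ph 0 * fst (snd p) + ph 1 * s"
      using n by (simp add: sum_first_two test_jet_def)
    have "0 = prolong ?n X Delta ?J"
      using GS_generatorD(2)[OF X, of ?J] p Delta_test_jet[OF n, of p s r] by (simp add: r_def)
    also have "\<dots> = Z ?n s + r * ?T + (\<Sum>k<?n. ?c k * Z k s) + (\<Sum>k<?n. ph k * fst (snd ?J k))"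
      using prolong_Delta[OF U sX, of ?J] p low top by (simp add: ph_def)
    also have "\<dots> = (\<Sum>k\<le>?n. ?c k * Z k s) + r * ?T + (ph 0 * fst (snd p) + ph 1 * s)"
      unfolding ph by (simp flip: lessThan_Suc_atMost)
    also have "r * ?T = - (?c 0 * fst (snd p) + ?c 1 * s) * ?T"
      by (simp add: r_def)
    finally show ?thesis by linarith
  qed
  have "(\<Sum>k\<le>?n. ?c k * second_diff X k p)
      = (\<Sum>k\<le>?n. ?c k * Z k 1) + (\<Sum>k\<le>?n. ?c k * Z k (-1)) - 2 * (\<Sum>k\<le>?n. ?c k * Z k 0)"
    by (simp add: second_diff_def Z_def algebra_simps sum.distrib sum_subtractf sum_distrib_left)
  then show ?thesis
    using E[of 1] E[of "-1"] E[of 0] unfolding dxi_def[symmetric] by (simp add: algebra_simps)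
qed

text \<open>The functions \<open>c\<^sub>0, \<dots>, c\<^bsub>n-1\<^esub>\<close> and \<open>c\<^sub>n = 1\<close> are linearly independent on every ball.\<close>

lemma coef_combination_zero:
  fixes c :: "real ^ 'n::finite"
  assumes e: "e > 0" and zero: "\<And>c'. c' \<in> ball c e \<Longrightarrow> (\<Sum>k\<le>CARD('n). coef c' k * a k) = 0"
    and m: "m \<le> CARD('n)"
  shows "a m = 0"
proof -
  have low: "a k = 0" if k: "k < CARD('n)" for k
  proof -
    define u :: "real ^ 'n" where "u = coef_vec (\<lambda>i. if i = k then 1 else 0)"
    \<comment> \<open>the summand 1 keeps the divisor positive without an estimate for \<open>u\<close>\<close>
    define m where "m = norm u + 1"
    have m: "m > 0" "norm u < m" using norm_ge_zero[of u] unfolding m_def by linarith+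
    define t where "t = e / (2 * m)"
    have t: "t > 0" using e m by (simp add: t_def)
    have "t * norm u < t * m" using t m by simp
    also have "\<dots> = e / 2" using m by (simp add: t_def)
    finally have "t * norm u < e" using e by linarith
    then have c': "c + t *\<^sub>R u \<in> ball c e" using t by (simp add: dist_norm)
    have "coef (c + t *\<^sub>R u) i = coef c i + t * (if i = k then 1 else 0)" if "i \<le> CARD('n)" for i
    proof (cases "i = CARD('n)")
      case False
      then have "coef (c + t *\<^sub>R u) i = coef c i + t * coef u i" by (simp add: coef_def)
      then show ?thesis using False that by (simp add: u_def coef_coef_vec)
    qed (use k in simp)
    then have "(\<Sum>i\<le>CARD('n). coef (c + t *\<^sub>R u) i * a i)
        = (\<Sum>i\<le>CARD('n). coef c i * a i + (if i = k then t * a k else 0))"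
      by (intro sum.cong) (auto simp: algebra_simps)
    also have "\<dots> = (\<Sum>i\<le>CARD('n). coef c i * a i) + t * a k"
      using k by (simp add: sum.distrib)
    finally have "t * a k = 0" using zero[OF c'] zero[of c] e by simp
    then show ?thesis using t by simp
  qed
  have "(\<Sum>k\<le>CARD('n). coef c k * a k) = a CARD('n)"
    using low by (simp flip: lessThan_Suc_atMost)
  then show ?thesis using zero[of c] e low m by (cases "m = CARD('n)") auto
qed

text \<open>On a box around the point, \<open>\<xi>\<close> and \<open>\<eta>\<close> are functions of \<open>x\<close> and \<open>y\<close>, since their \<open>c\<close>-derivatives
  vanish and balls are convex.\<close>

lemma second_diff_locally_coefficient_free:
  fixes U :: "'n::finite pt set"
  assumes n: "CARD('n) \<ge> 2" and U: "open U" and X: "GS_generator U X" and p: "(x, y, c) \<in> U"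
  shows "\<exists>e>0. \<forall>c'\<in>ball c e. (x, y, c') \<in> U \<and> (\<forall>k. second_diff X k (x, y, c') = second_diff X k (x, y, c))"
proof -
  obtain A B' where A: "open A" "open B'" "(x, y, c) \<in> A \<times> B'" "A \<times> B' \<subseteq> U"
    using open_prod_elim[OF U p] by metis
  then have yc: "(y, c) \<in> B'" by simp
  obtain B C where B: "open B" "open C" "(y, c) \<in> B \<times> C" "B \<times> C \<subseteq> B'"
    using open_prod_elim[OF A(2) yc] by metis
  then have "c \<in> C" by simp
  then obtain e where e: "e > 0" "ball c e \<subseteq> C" using openE[OF B(2)] by metis
  define U' where "U' = A \<times> B \<times> ball c e"
  have "B \<times> ball c e \<subseteq> B'" using B(4) e(2) by blast
  then have "U' \<subseteq> A \<times> B'" unfolding U'_def by blast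
  then have U': "open U'" "U' \<subseteq> U" using A B by (auto simp: U'_def intro!: open_Times)
  have sX: "smooth_on U' X" using GS_generatorD(1)[OF X] U'(2) by (rule smooth_on_subset)
  have const: "F (x', y', c1) = F (x', y', c2)"
    if F: "smooth_on U F" "\<And>p v. p \<in> U \<Longrightarrow> frechet_derivative F (at p) (0, 0, v) = 0"
      and m: "(x', y', c1) \<in> U'" "(x', y', c2) \<in> U'" for F :: "'n pt \<Rightarrow> real" and x' y' c1 c2
  proof -
    have "F ((x', y', c2) + (0, 0, c1 - c2)) = F (x', y', c2)"
    proof (rule constant_along_segment[OF F(1) F(2)])
      fix t :: real assume t: "t \<in> {0..1}"
      have "(1 - t) *\<^sub>R c2 + t *\<^sub>R c1 \<in> ball c e"
        using m t by (intro convexD[OF convex_ball]) (auto simp: U'_def)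
      then have "(x', y', c2) + t *\<^sub>R (0, 0, c1 - c2) \<in> U'"
        using m by (simp add: U'_def algebra_simps)
      then show "(x', y', c2) + t *\<^sub>R (0, 0, c1 - c2) \<in> U" using U'(2) by blast
    qed
    then show ?thesis by simp
  qed
  note sXU = GS_generatorD(1)[OF X]
  have ind: "fst (X (x', y', c1)) = fst (X (x', y', c2)) \<and> fst (snd (X (x', y', c1))) = fst (snd (X (x', y', c2)))"
    if "(x', y', c1) \<in> U'" "(x', y', c2) \<in> U'" for x' y' c1 c2
    using const[OF smooth_xi[OF U sXU] GS_generator_coefficient_free(1)[OF n U X] that]
      const[OF smooth_eta[OF U sXU] GS_generator_coefficient_free(2)[OF n U X] that] by simp
  have Z: "y_coeff X k (test_jet (x, y, c') s 0) = y_coeff X k (test_jet (x, y, c) s 0)" if "c' \<in> ball c e" for c' s k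
    by (rule y_coeff_coefficient_free[OF U'(1) sX ind]) (use A B e that in \<open>auto simp: U'_def test_jet_def base_def\<close>)
  have "(x, y, c') \<in> U \<and> (\<forall>k. second_diff X k (x, y, c') = second_diff X k (x, y, c))" if "c' \<in> ball c e" for c'
    using Z[OF that] A B e that U'(2) by (auto simp: second_diff_def U'_def)
  then show ?thesis using e(1) by blast
qed

lemma second_diff_1:
  assumes U: "open U" and X: "smooth_on U X" and p: "p \<in> U"
  shows "second_diff X 1 p = - 2 * frechet_derivative (\<lambda>p. fst (X p)) (at p) (0, 1, 0)"
proof -
  have 1: "frechet_derivative F (at p) (1, s, 0) = frechet_derivative F (at p) (1, 0, 0) + s * frechet_derivative F (at p) (0, 1, 0)"
    if "smooth_on U F" for F :: "'a pt \<Rightarrow> real" and s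
    using frechet_split[OF that p, of "(1, 0, 0)" s "(0, 1, 0)"] by simp
  have Z: "y_coeff X 1 (test_jet p s 0) = frechet_derivative (\<lambda>p. fst (snd (X p))) (at p) (1, 0, 0)
      + s * frechet_derivative (\<lambda>p. fst (snd (X p))) (at p) (0, 1, 0)
      - s * (frechet_derivative (\<lambda>p. fst (X p)) (at p) (1, 0, 0)
      + s * frechet_derivative (\<lambda>p. fst (X p)) (at p) (0, 1, 0))" for s
    using y_coeff_1[OF U X, of "test_jet p s 0"] p 1[OF smooth_xi[OF U X], of s] 1[OF smooth_eta[OF U X], of s]
    by (simp del: prolong_coeff.simps)
  show ?thesis unfolding second_diff_def Z by (simp add: algebra_simps)
qed

text \<open>Since \<open>\<xi>\<^sub>y\<close> is a multiple of the second difference of \<open>\<zeta>'\<close>, the relation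
  of \<open>GS_generator_second_diff\<close> is a combination of \<open>c\<^sub>0, \<dots>, c\<^sub>n\<close> with coefficients independent of \<open>c\<close>
  near the point. All of these coefficients vanish. For \<open>\<zeta>'\<close> the coefficient is \<open>-n\<close> times the second
  difference, and for \<open>\<zeta>''\<close> it is the second difference itself.\<close>

lemma GS_generator_second_diff_zero:
  fixes U :: "'n::finite pt set"
  assumes n: "CARD('n) \<ge> 2" and U: "open U" and X: "GS_generator U X" and p: "p \<in> U"
  shows "second_diff X 1 p = 0" "second_diff X 2 p = 0"
proof -
  obtain x y c where pq: "p = (x, y, c)" by (cases p)
  let ?n = "CARD('n)"
  define a where "a k = second_diff X k p - (if k = 1 then (real ?n + 1) * second_diff X 1 p else 0)" for k
  obtain e where e: "e > 0" "\<And>c'. c' \<in> ball c e \<Longrightarrow> (x, y, c') \<in> U"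
    "\<And>c' k. c' \<in> ball c e \<Longrightarrow> second_diff X k (x, y, c') = second_diff X k p"
    using second_diff_locally_coefficient_free[OF n U X] p unfolding pq by blast
  have "a k = 0" if "k \<le> ?n" for k
  proof (rule coef_combination_zero[OF e(1) _ that])
    fix c' assume c': "c' \<in> ball c e"
    have "(\<Sum>k\<le>?n. coef c' k * a k) = (\<Sum>k\<le>?n. coef c' k * second_diff X k p
        - (if k = 1 then coef c' 1 * (real ?n + 1) * second_diff X 1 p else 0))"
      by (intro sum.cong) (auto simp: a_def algebra_simps)
    also have "\<dots> = (\<Sum>k\<le>?n. coef c' k * second_diff X k p) - coef c' 1 * (real ?n + 1) * second_diff X 1 p"
      using n by (simp add: sum_subtractf)
    also have "\<dots> = 0"
      using GS_generator_second_diff[OF n U X e(2)[OF c']] e(3)[OF c']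
        second_diff_1[OF U GS_generatorD(1)[OF X] e(2)[OF c']] by (simp add: algebra_simps)
    finally show "(\<Sum>k\<le>?n. coef c' k * a k) = 0" .
  qed
  from this[of 1] this[of 2] n show "second_diff X 1 p = 0" "second_diff X 2 p = 0"
    by (simp_all add: a_def algebra_simps)
qed

text \<open>Once \<open>\<xi>\<^sub>y = 0\<close>, \<open>y'\<close> occurs quadratically in \<open>\<zeta>''\<close> only in \<open>y'\<^sup>2 \<eta>\<^bsub>yy\<^esub>\<close>; the term
  \<open>y'\<^sup>2 \<xi>\<^bsub>xy\<^esub>\<close> vanishes because \<open>\<xi>\<^sub>x\<close> is invariant in direction \<open>y\<close> together with \<open>\<xi>\<close>.\<close>

lemma second_diff_2:
  fixes U :: "'n::finite pt set"
  assumes U: "open U" and X: "smooth_on U X" and p: "p \<in> U" and n: "CARD('n) \<ge> 2"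
    and xi_y: "\<And>q. q \<in> U \<Longrightarrow> frechet_derivative (\<lambda>p. fst (X p)) (at q) (0, 1, 0) = 0"
  shows "second_diff X 2 p
    = 2 * frechet_derivative (\<lambda>q. frechet_derivative (\<lambda>p. fst (snd (X p))) (at q) (0, 1, 0)) (at p) (0, 1, 0)"
proof -
  note se = smooth_eta[OF U X] and sx = smooth_xi[OF U X]
  define P where "P q = frechet_derivative (\<lambda>p. fst (snd (X p))) (at q) (1, 0, 0)" for q
  define Q where "Q q = frechet_derivative (\<lambda>p. fst (snd (X p))) (at q) (0, 1, 0)" for q
  define R where "R q = frechet_derivative (\<lambda>p. fst (X p)) (at q) (1, 0, 0)" for q
  have sm: "smooth_on U P" "smooth_on U Q" "smooth_on U R"
    unfolding P_def Q_def R_def using se sx by (auto intro: smooth_on_directional)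
  define d where "d F = frechet_derivative F (at p)" for F :: "'n pt \<Rightarrow> real"
  have d_split: "d F (1, s, 0) = d F (1, 0, 0) + s * d F (0, 1, 0)" if "smooth_on U F" for F s
    using frechet_split[OF that p, of "(1, 0, 0)" s "(0, 1, 0)"] by (simp add: d_def)
  have R_y: "d R (0, 1, 0) = 0"
    unfolding d_def R_def by (rule directional_derivative_zero_commute[OF U sx xi_y p])
  have Z: "y_coeff X 2 (test_jet p s 0) = d P (1, 0, 0) + s * d P (0, 1, 0)
      + s * (d Q (1, 0, 0) + s * d Q (0, 1, 0)) - s * d R (1, 0, 0)" for s
  proof -
    let ?J = "test_jet p s 0"
    let ?a = "\<lambda>q. P q + s * Q q - s * R q"
    have J2: "snd ?J (Suc (Suc 0)) = 0" by (simp add: test_jet_def zero_prod_def)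
    have Z1: "y_coeff X (Suc 0) (line ?J (shift_jet ?J) t) = ?a (base (line ?J (shift_jet ?J) t))"
      if b: "base (line ?J (shift_jet ?J) t) \<in> U" for t
    proof -
      let ?q = "base (line ?J (shift_jet ?J) t)"
      have "snd (line ?J (shift_jet ?J) t) 1 = (s, 0)" by (simp add: J2)
      then show ?thesis
        using y_coeff_1[OF U X b] frechet_split[OF se b, of "(1, 0, 0)" s "(0, 1, 0)"]
          frechet_split[OF sx b, of "(1, 0, 0)" s "(0, 1, 0)"] xi_y[OF b]
        by (simp add: P_def Q_def R_def del: snd_line prolong_coeff.simps)
    qed
    have sa: "smooth_on U ?a"
      by (intro smooth_on_add smooth_on_diff smooth_on_mult smooth_on_const sm U)
    have "y_coeff X 2 ?J = along (y_coeff X (Suc 0)) ?J (shift_jet ?J)"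
      using y_coeff_Suc[OF U X, of ?J "Suc 0"] p J2 by (simp add: numeral_2_eq_2 del: prolong_coeff.simps)
    also have "\<dots> = along (\<lambda>J. ?a (base J)) ?J (shift_jet ?J)"
      unfolding along_line
    proof (rule vector_derivative_cong_eq)
      show "\<forall>\<^sub>F t in nhds 0. t \<in> UNIV \<longrightarrow> y_coeff X (Suc 0) (line ?J (shift_jet ?J) t) = ?a (base (line ?J (shift_jet ?J) t))"
        using eventually_base_line[OF U, of ?J "shift_jet ?J"] p
        by (auto elim!: eventually_mono intro!: Z1 simp del: prolong_coeff.simps)
    qed auto
    also have "\<dots> = d ?a (1, s, 0)"
      using along_base[OF sa, of ?J "shift_jet ?J"] p by (simp add: d_def)
    also have "d ?a = (\<lambda>v. d P v + s * d Q v - s * d R v)"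
      unfolding d_def
      by (rule frechet_derivative_at[symmetric])
        (intro has_derivative_add has_derivative_diff has_derivative_mult_right smooth_on_has_derivative[OF sm(1) p]
          smooth_on_has_derivative[OF sm(2) p] smooth_on_has_derivative[OF sm(3) p])
    finally show ?thesis
      using d_split[OF sm(1), of s] d_split[OF sm(2), of s] d_split[OF sm(3), of s] by (simp add: R_y)
  qed
  show ?thesis
    unfolding second_diff_def Z Q_def[symmetric] d_def[symmetric] by (simp add: Q_def d_def algebra_simps)
qed

text \<open>The functions \<open>f = \<xi>\<close>, \<open>g = \<eta>\<^sub>y\<close> and \<open>h = \<eta> - y \<eta>\<^sub>y\<close> have vanishing derivative along the fibres
  over \<open>x\<close>: the equations \<open>\<xi>\<^sub>y = 0\<close> and \<open>\<eta>\<^bsub>yy\<^esub> = 0\<close> come from the second differences, and the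
  equations \<open>\<xi>\<^sub>c = 0\<close> and \<open>\<eta>\<^sub>c = 0\<close> from the highest derivative of \<open>c\<close>.\<close>

lemma GS_generator_affine:
  fixes U :: "'n::finite pt set"
  assumes n: "CARD('n) \<ge> 2" and U: "open U" "\<And>x. connected {u. (x, u) \<in> U}" and X: "GS_generator U X"
  shows "\<exists>f g h. smooth_on (fst ` U) f \<and> smooth_on (fst ` U) g \<and> smooth_on (fst ` U) h \<and>
    (\<forall>p\<in>U. fst (X p) = f (fst p) \<and> fst (snd (X p)) = fst (snd p) * g (fst p) + h (fst p))"
proof -
  note sX = GS_generatorD(1)[OF X]
  note se = smooth_eta[OF U(1) sX] and sx = smooth_xi[OF U(1) sX]
  have fibre: "frechet_derivative F (at p) (0, w, v) = 0"
    if "smooth_on U F" "p \<in> U" "frechet_derivative F (at p) (0, 1, 0) = 0" "frechet_derivative F (at p) (0, 0, v) = 0"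
    for F :: "'n pt \<Rightarrow> real" and p w v
    using frechet_split[OF that(1,2), of "(0, 0, v)" w "(0, 1, 0)"] that(3,4) by simp
  have xi_y: "frechet_derivative (\<lambda>p. fst (X p)) (at p) (0, 1, 0) = 0" if "p \<in> U" for p
    using GS_generator_second_diff_zero(1)[OF n U(1) X that] second_diff_1[OF U(1) sX that] by simp
  have "frechet_derivative (\<lambda>p. fst (X p)) (at p) (0, w) = 0" if "p \<in> U" for p w
    using fibre[OF sx that xi_y[OF that] GS_generator_coefficient_free(1)[OF n U(1) X that]] by (cases w) auto
  then obtain f where f: "smooth_on (fst ` U) f" "\<forall>p\<in>U. fst (X p) = f (fst p)"
    using fibrewise_constant[OF U sx] by blast
  define G where "G q = frechet_derivative (\<lambda>p. fst (snd (X p))) (at q) (0, 1, 0)" for q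
  have sG: "smooth_on U G" unfolding G_def using se by (rule smooth_on_directional)
  have "frechet_derivative G (at p) (0, w) = 0" if p: "p \<in> U" for p w
  proof -
    have "frechet_derivative G (at p) (0, 1, 0) = 0"
      using second_diff_2[OF U(1) sX p n xi_y] GS_generator_second_diff_zero(2)[OF n U(1) X p]
      by (simp add: G_def[abs_def])
    moreover have "frechet_derivative G (at p) (0, 0, v) = 0" for v
      unfolding G_def
      by (rule directional_derivative_zero_commute[OF U(1) se GS_generator_coefficient_free(2)[OF n U(1) X] p])
    ultimately show ?thesis using fibre[OF sG p] by (cases w) auto
  qed
  then obtain g where g: "smooth_on (fst ` U) g" "\<forall>p\<in>U. G p = g (fst p)"
    using fibrewise_constant[OF U sG] by blast
  define H where "H q = fst (snd (X q)) - fst (snd q) * g (fst q)" for q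
  have H: "H (x, y, c) = fst (snd (X (x, y, c))) - y * g x" for x y c by (simp add: H_def)
  have sg: "smooth_on U (\<lambda>p. g (fst p))"
    using smooth_on_compose_fst[OF U(1) g(1), of 0] by simp
  have sH: "smooth_on U H"
    unfolding H_def by (intro smooth_on_diff smooth_on_mult smooth_on_fst smooth_on_snd smooth_on_id se sg U(1))
  have "frechet_derivative H (at p) (0, w, v) = 0" if p: "p \<in> U" for p w v
  proof -
    obtain x u where xu: "p = (x, u)" by (cases p)
    have line: "p + t *\<^sub>R (0, w, v) = (x, u + t *\<^sub>R (w, v))" for t :: real by (simp add: xu)
    let ?e = "frechet_derivative (\<lambda>p. fst (snd (X p))) (at p)"
    have "((\<lambda>t. fst (snd (X (p + t *\<^sub>R (0, w, v))))) has_real_derivative ?e (0, w, v)) (at 0)"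
      using has_derivative_along_line[OF se, of p 0 "(0, w, v)"] p
      by (simp add: has_real_derivative_iff_has_vector_derivative del: scaleR_Pair)
    moreover have "?e (0, w, v) = w * G p"
      using frechet_split[OF se p, of "(0, 0, v)" w "(0, 1, 0)"] GS_generator_coefficient_free(2)[OF n U(1) X p, of v]
      by (simp add: G_def)
    moreover have "((\<lambda>t. (fst u + t * w) * g x) has_real_derivative w * g x) (at 0)"
      by (auto intro!: derivative_eq_intros)
    ultimately have "((\<lambda>t. fst (snd (X (p + t *\<^sub>R (0, w, v)))) - (fst u + t * w) * g x) has_real_derivative 0) (at 0)"
      using g(2) p xu by (auto intro!: derivative_eq_intros)
    moreover have "((\<lambda>t. H (p + t *\<^sub>R (0, w, v))) has_real_derivative frechet_derivative H (at p) (0, w, v)) (at 0)"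
      using has_derivative_along_line[OF sH, of p 0 "(0, w, v)"] p
      by (simp add: has_real_derivative_iff_has_vector_derivative del: scaleR_Pair)
    moreover have "H (p + t *\<^sub>R (0, w, v)) = fst (snd (X (p + t *\<^sub>R (0, w, v)))) - (fst u + t * w) * g x" for t
      by (simp add: H_def xu)
    ultimately show ?thesis using DERIV_unique by (metis (no_types, lifting) ext)
  qed
  then obtain h where h: "smooth_on (fst ` U) h" "\<forall>p\<in>U. H p = h (fst p)"
    using fibrewise_constant[OF U sH] by (metis prod.collapse)
  have "\<forall>p\<in>U. fst (X p) = f (fst p) \<and> fst (snd (X p)) = fst (snd p) * g (fst p) + h (fst p)"
    using f(2) h(2) by (auto simp: H)
  then show ?thesis using f(1) g(1) h(1) by blast
qed

section \<open>The induced action on the coefficients\<close>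

lemma deriv_iterate_zero: "(deriv ^^ j) (\<lambda>_. 0 :: real) = (\<lambda>_. 0)"
  by (induction j) auto

lemma Phi_zero: "Phi f g (\<lambda>_. 0) x y c k = Phi0 f g x c k"
  by (simp add: Phi_def Phi0_def deriv_iterate_zero algebra_simps del: funpow.simps)

text \<open>Every map \<open>(z, w) \<mapsto> (f(z), g(z) w)\<close> has a first component that is independent of \<open>w\<close> and a second
  component proportional to \<open>w\<close>. Both properties are linear, and so pass to the derivative of a family of such maps.\<close>

lemma G_generator_fibre:
  assumes V: "G_generator W V" and p: "(x, y) \<in> W"
  shows "eventually (\<lambda>y'. fst (V (x, y')) = fst (V (x, y)) \<and> snd (V (x, y')) * y = snd (V (x, y)) * y') (nhds y)"
proof -
  obtain N e T where N: "open N" "(x, y) \<in> N" and e: "0 < e"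
    and T: "\<And>t. t \<in> {-e<..<e} \<Longrightarrow> equivalence_map N (T t)"
    and dT: "\<And>q. q \<in> N \<Longrightarrow> ((\<lambda>t. T t q) has_vector_derivative V q) (at 0)"
    using V p unfolding G_generator_def by metis
  obtain A B where AB: "open A" "open B" "(x, y) \<in> A \<times> B" "A \<times> B \<subseteq> N"
    using open_prod_elim[OF N] by metis
  have d: "((\<lambda>t. fst (T t q)) has_vector_derivative fst (V q)) (at 0)"
    "((\<lambda>t. snd (T t q)) has_vector_derivative snd (V q)) (at 0)" if "q \<in> N" for q
    using bounded_linear.has_vector_derivative[OF bounded_linear_fst dT[OF that]]
      bounded_linear.has_vector_derivative[OF bounded_linear_snd dT[OF that]] by simp_all
  have "fst (V (x, y')) = fst (V (x, y)) \<and> snd (V (x, y')) * y = snd (V (x, y)) * y'" if y': "y' \<in> B" for y'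
  proof -
    have m: "(x, y') \<in> N" "(x, y) \<in> N" using AB y' by auto
    have eq: "fst (T t (x, y')) = fst (T t (x, y))" "snd (T t (x, y')) * y = snd (T t (x, y)) * y'"
      if t: "t \<in> {-e<..<e}" for t
    proof -
      obtain f g where "\<forall>(z, w)\<in>N. T t (z, w) = (f z, g z * w)"
        using T[OF t] unfolding equivalence_map_def by blast
      then have "T t (x, y') = (f x, g x * y')" "T t (x, y) = (f x, g x * y)" using m by auto
      then show "fst (T t (x, y')) = fst (T t (x, y))" "snd (T t (x, y')) * y = snd (T t (x, y)) * y'" by auto
    qed
    have "((\<lambda>t. fst (T t (x, y))) has_vector_derivative fst (V (x, y'))) (at 0)"
      by (rule has_vector_derivative_transform_within_open[OF d(1)[OF m(1)], of "{-e<..<e}"]) (use e eq in auto)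
    then have 1: "fst (V (x, y')) = fst (V (x, y))"
      using d(1)[OF m(2)] by (rule vector_derivative_unique_at)
    have r: "((\<lambda>t. snd (T t (x, y')) * y) has_vector_derivative snd (V (x, y')) * y) (at 0)"
      "((\<lambda>t. snd (T t (x, y)) * y') has_vector_derivative snd (V (x, y)) * y') (at 0)"
      using bounded_linear.has_vector_derivative[OF bounded_linear_mult_left d(2)] m by auto
    have "((\<lambda>t. snd (T t (x, y)) * y') has_vector_derivative snd (V (x, y')) * y) (at 0)"
      by (rule has_vector_derivative_transform_within_open[OF r(1), of "{-e<..<e}"]) (use e eq in auto)
    then have "snd (V (x, y')) * y = snd (V (x, y)) * y'"
      using r(2) by (rule vector_derivative_unique_at)
    with 1 show ?thesis by simp
  qed
  moreover have "eventually (\<lambda>y'. y' \<in> B) (nhds y)"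
    using AB by (intro eventually_nhds_in_open) auto
  ultimately show ?thesis by (rule eventually_mono[rotated])
qed

text \<open>The condition on the projection makes \<open>\<xi>\<close> and \<open>\<eta> / y\<close> functions of \<open>x\<close> directly, for every
  order including \<open>n = 1\<close>, and forces \<open>h = 0\<close>. The \<open>c\<close>-components are then determined as before.\<close>

lemma Gc_generator_imp:
  fixes U :: "'n::finite pt set"
  assumes U: "open U" "\<And>x. connected {u. (x, u) \<in> U}" "\<And>x y c. (x, y, c) \<in> U \<Longrightarrow> y \<noteq> 0"
    and Y: "Gc_generator U Y"
  shows "\<exists>f g. smooth_on (fst ` U) f \<and> smooth_on (fst ` U) g \<and> (\<forall>(x, y, c)\<in>U. Y (x, c) = X_c f g (x, c))"
proof -
  obtain X V where X: "GS_generator U X" and V: "G_generator ((\<lambda>(x, y, c). (x, y)) ` U) V"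
    and XV: "\<And>x y c. (x, y, c) \<in> U \<Longrightarrow> V (x, y) = (fst (X (x, y, c)), fst (snd (X (x, y, c))))
      \<and> Y (x, c) = (fst (X (x, y, c)), snd (snd (X (x, y, c))))"
    using Y unfolding Gc_generator_def by (fastforce simp: case_prod_beta)
  note sX = GS_generatorD(1)[OF X]
  note se = smooth_eta[OF U(1) sX] and sx = smooth_xi[OF U(1) sX]
  have loc: "eventually (\<lambda>u'. (x, u') \<in> U \<and> fst (X (x, u')) = fst (X (x, u)) \<and>
      fst (snd (X (x, u'))) / fst u' = fst (snd (X (x, u))) / fst u) (nhds u)" if xu: "(x, u) \<in> U" for x u
  proof -
    obtain y c where u: "u = (y, c)" by (cases u)
    have W: "(x, y) \<in> (\<lambda>(x, y, c). (x, y)) ` U" using xu u by force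
    have "eventually (\<lambda>u'. fst (V (x, fst u')) = fst (V (x, y)) \<and> snd (V (x, fst u')) * y = snd (V (x, y)) * fst u') (nhds u)"
      using G_generator_fibre[OF V W] unfolding u by (rule eventually_compose_filterlim)
        (use tendsto_fst[OF filterlim_ident[of "nhds (y, c)"]] in simp)
    moreover have "eventually (\<lambda>u'. (x, u') \<in> U) (nhds u)"
    proof -
      obtain A B where AB: "open A" "open B" "(x, u) \<in> A \<times> B" "A \<times> B \<subseteq> U"
        using open_prod_elim[OF U(1) xu] by metis
      then have "eventually (\<lambda>u'. u' \<in> B) (nhds u)" by (intro eventually_nhds_in_open) auto
      then show ?thesis by eventually_elim (use AB in auto)
    qed
    ultimately show ?thesis
    proof eventually_elim
      case (elim u')
      obtain y' c' where u': "u' = (y', c')" by (cases u')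
      show ?case
        using elim XV[of x y c] XV[of x y' c'] xu U(3)[of x y c] U(3)[of x y' c'] unfolding u u'
        by (auto simp: frac_eq_eq mult.commute)
    qed
  qed
  have "\<exists>f. smooth_on (fst ` U) f \<and> (\<forall>p\<in>U. fst (X p) = f (fst p))"
    by (rule locally_fibrewise_constant[OF U(1,2) sx], drule loc) (auto elim: eventually_mono)
  then obtain f where f: "smooth_on (fst ` U) f" "\<And>p. p \<in> U \<Longrightarrow> fst (X p) = f (fst p)" by blast
  have sq: "smooth_on U (\<lambda>p. fst (snd (X p)) / fst (snd p))"
    by (intro smooth_on_divide se smooth_on_fst smooth_on_snd smooth_on_id U(1)) (use U(3) in auto)
  have "\<exists>g. smooth_on (fst ` U) g \<and> (\<forall>p\<in>U. fst (snd (X p)) / fst (snd p) = g (fst p))"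
    by (rule locally_fibrewise_constant[OF U(1,2) sq], drule loc) (auto elim: eventually_mono)
  then obtain g where g: "smooth_on (fst ` U) g" "\<And>p. p \<in> U \<Longrightarrow> fst (snd (X p)) / fst (snd p) = g (fst p)" by blast
  have eta: "fst (snd (X p)) = fst (snd p) * g (fst p) + (\<lambda>_. 0) (fst p)" if "p \<in> U" for p
    using g(2)[OF that] U(3)[of "fst p" "fst (snd p)" "snd (snd p)"] that by (auto simp: field_simps)
  have "smooth_on (fst ` U) (\<lambda>_. 0 :: real)"
    using open_image_fst[OF U(1)] by (rule smooth_on_const)
  from GS_generator_affine_field_unique[OF U(1) _ f(1) g(1) this X f(2) eta] U(3)
  have XS: "X p = X_S f g (\<lambda>_. 0) p" if "p \<in> U" for p
    using that by blast
  have "Y (x, c) = X_c f g (x, c)" if "(x, y, c) \<in> U" for x y c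
    using XV[OF that] XS[OF that] by (simp add: X_S_def X_c_def Phi_zero[abs_def])
  then have "\<forall>(x, y, c)\<in>U. Y (x, c) = X_c f g (x, c)" by auto
  then show ?thesis using f(1) g(1) by blast
qed

text \<open>A family of equivalence transformations need not be a flow, so the affine family
  \<open>z + t f(z)\<close>, \<open>(1 + t g(z)) w\<close> suffices. Where \<open>f'\<close> and \<open>g\<close> are bounded by \<open>M\<close> it consists of
  invertible maps for \<open>\<bar>t\<bar> < 1 / M\<close>.\<close>

lemma G_generator_linear:
  assumes S: "open S" and W: "open W" "W \<subseteq> S \<times> UNIV"
    and fg: "smooth_on S f" "smooth_on S g"
  shows "G_generator W (\<lambda>(x, y). (f x, y * g x))"
  unfolding G_generator_def
proof
  fix p assume p: "p \<in> W"
  obtain x0 y0 where p0: "p = (x0, y0)" by (cases p)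
  obtain A B where AB: "open A" "open B" "(x0, y0) \<in> A \<times> B" "A \<times> B \<subseteq> W"
    using open_prod_elim[OF W(1)] p p0 by metis
  then have xA: "x0 \<in> A" and yB: "y0 \<in> B" by auto
  obtain r where r: "r > 0" "cball x0 r \<subseteq> A" using AB(1) xA by (meson open_contains_cball)
  have AS: "A \<subseteq> S" using AB(4) W(2) yB by blast
  define I where "I = ball x0 r"
  define N where "N = I \<times> B"
  have I: "open I" "convex I" "I \<subseteq> cball x0 r" "I \<subseteq> S" "x0 \<in> I"
    using r(1) subset_trans[OF ball_subset_cball[of x0 r] subset_trans[OF r(2) AS]] by (simp_all add: I_def)
  have N: "open N" "p \<in> N" "N \<subseteq> W" "fst ` N = I"
    using I AB(2,4) r(2) yB p0 by (auto simp: N_def intro!: open_Times)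
  have df: "(f has_real_derivative deriv f z) (at z)" if "z \<in> S" for z
    using smooth_on_has_real_derivative[OF fg(1) that] .
  have bound: "\<exists>M. \<forall>z\<in>I. \<bar>a z\<bar> \<le> M" if "smooth_on S a" for a :: "real \<Rightarrow> real"
  proof -
    have "continuous_on S a" using that unfolding smooth_on_def by (metis Ck_on.simps(1))
    then have "continuous_on (cball x0 r) a" by (rule continuous_on_subset) (use r AS in blast)
    then have "bounded (a ` cball x0 r)" by (intro compact_imp_bounded compact_continuous_image) auto
    then show ?thesis using I(3) unfolding bounded_iff by auto
  qed
  obtain M1 M2 where M12: "\<And>z. z \<in> I \<Longrightarrow> \<bar>deriv f z\<bar> \<le> M1" "\<And>z. z \<in> I \<Longrightarrow> \<bar>g z\<bar> \<le> M2"
    using bound[OF smooth_on_deriv[OF S fg(1)]] bound[OF fg(2)] by blast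
  \<comment> \<open>at least 1, so that \<open>1 / M\<close> is positive even for \<open>f = g = 0\<close>\<close>
  define M where "M = max 1 (max M1 M2)"
  have M: "M > 0" "\<And>z. z \<in> I \<Longrightarrow> \<bar>deriv f z\<bar> \<le> M" "\<And>z. z \<in> I \<Longrightarrow> \<bar>g z\<bar> \<le> M"
    using M12 unfolding M_def by force+
  define e where "e = 1 / M"
  have e: "e > 0" using M(1) by (simp add: e_def)
  define T where "T t = (\<lambda>(z, w). (z + t * f z, (1 + t * g z) * w))" for t :: real
  have small: "\<bar>t\<bar> * M < 1" if "t \<in> {-e<..<e}" for t
    using that M(1) by (auto simp: e_def field_simps abs_if)
  have nz: "1 + t * a \<noteq> 0" if t: "t \<in> {-e<..<e}" and a: "\<bar>a\<bar> \<le> M" for t a :: real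
  proof -
    have "\<bar>t * a\<bar> \<le> \<bar>t\<bar> * M" using a by (simp add: abs_mult mult_left_mono)
    then show ?thesis using small[OF t] by linarith
  qed
  have eqv: "equivalence_map N (T t)" if t: "t \<in> {-e<..<e}" for t
    unfolding equivalence_map_def N(4)
  proof (rule exI[of _ "\<lambda>z. z + t * f z"], rule exI[of _ "\<lambda>z. 1 + t * g z"], intro conjI ballI)
    show "smooth_on I (\<lambda>z. z + t * f z)" "smooth_on I (\<lambda>z. 1 + t * g z)"
      using fg I(1,4)
      by (auto intro!: smooth_on_add smooth_on_mult smooth_on_id smooth_on_const intro: smooth_on_subset)
    show "inj_on (\<lambda>z. z + t * f z) I"
    proof (rule inj_onI)
      fix z z' assume z: "z \<in> I" "z' \<in> I" and eq: "z + t * f z = z' + t * f z'"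
      have "norm (f z - f z') \<le> M * norm (z - z')"
        using df I(4) M(2) z by (intro field_differentiable_bound[OF I(2)])
          (auto intro: has_field_derivative_at_within)
      then have "\<bar>t\<bar> * \<bar>f z - f z'\<bar> \<le> \<bar>t\<bar> * (M * \<bar>z - z'\<bar>)"
        by (intro mult_left_mono) auto
      moreover have "\<bar>z - z'\<bar> = \<bar>t\<bar> * \<bar>f z - f z'\<bar>"
      proof -
        have "z - z' = - (t * (f z - f z'))" using eq by (simp add: algebra_simps)
        then show ?thesis by (simp add: abs_mult)
      qed
      ultimately have "\<bar>z - z'\<bar> * (1 - \<bar>t\<bar> * M) \<le> 0" by (simp add: algebra_simps)
      then show "z = z'" using small[OF t] by (simp add: mult_le_0_iff)
    qed
    fix z assume z: "z \<in> I"
    have "((\<lambda>z. z + t * f z) has_real_derivative 1 + t * deriv f z) (at z)"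
      using df[of z] z I(4) by (auto intro!: derivative_eq_intros)
    then show "deriv (\<lambda>z. z + t * f z) z \<noteq> 0" using nz[OF t M(2)[OF z]] by (simp add: DERIV_imp_deriv)
    show "1 + t * g z \<noteq> 0" using nz[OF t M(3)[OF z]] .
  next
    fix q assume "q \<in> N"
    then show "case q of (z, w) \<Rightarrow> T t (z, w) = (z + t * f z, (1 + t * g z) * w)" by (simp add: T_def split: prod.split)
  qed
  have smooth: "smooth_on ({-e<..<e} \<times> N) (\<lambda>(t, q). T t q)"
  proof -
    let ?D = "{-e<..<e} \<times> N"
    have D: "open ?D" using N(1) by (intro open_Times) auto
    have c: "smooth_on ?D (\<lambda>p. a (fst (snd p)))" if "smooth_on S a" for a :: "real \<Rightarrow> real"
      by (rule smooth_on_compose_real[OF D that]) (use D I(4) in \<open>auto simp: N_def intro!: smooth_intros\<close>)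
    have "smooth_on ?D (\<lambda>p. (fst (snd p) + fst p * f (fst (snd p)), (1 + fst p * g (fst (snd p))) * snd (snd p)))"
      by (intro smooth_on_Pair smooth_on_add smooth_on_mult smooth_on_fst smooth_on_snd smooth_on_id smooth_on_const c fg D)
    then show ?thesis by (simp add: T_def case_prod_beta')
  qed
  have der: "T 0 q = q \<and> ((\<lambda>t. T t q) has_vector_derivative (case q of (x, y) \<Rightarrow> (f x, y * g x))) (at 0)" for q
  proof -
    obtain z w where q: "q = (z, w)" by (cases q)
    have "((\<lambda>t. z + t * f z) has_vector_derivative f z) (at 0)" "((\<lambda>t. (1 + t * g z) * w) has_vector_derivative w * g z) (at 0)"
      unfolding has_real_derivative_iff_has_vector_derivative[symmetric]
      by (auto intro!: derivative_eq_intros)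
    then have "((\<lambda>t. (z + t * f z, (1 + t * g z) * w)) has_vector_derivative (f z, w * g z)) (at 0)"
      by (rule has_vector_derivative_Pair)
    then show ?thesis by (simp add: T_def q)
  qed
  show "\<exists>N e T. open N \<and> p \<in> N \<and> N \<subseteq> W \<and> 0 < e \<and>
     smooth_on ({-e<..<e} \<times> N) (\<lambda>(t, q). T t q) \<and>
     (\<forall>t\<in>{-e<..<e}. equivalence_map N (T t)) \<and>
     (\<forall>q\<in>N. T 0 q = q \<and> ((\<lambda>t. T t q) has_vector_derivative (case q of (x, y) \<Rightarrow> (f x, y * g x))) (at 0))"
    using N e smooth eqv der by blast
qed

lemma Gc_generator_X_c:
  fixes U :: "'n::finite pt set"
  assumes U: "open U" "\<And>x y c. (x, y, c) \<in> U \<Longrightarrow> y \<noteq> 0"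
    and fg: "smooth_on (fst ` U) f" "smooth_on (fst ` U) g"
    and Y: "\<And>x y c. (x, y, c) \<in> U \<Longrightarrow> Y (x, c) = X_c f g (x, c)"
  shows "Gc_generator U Y"
proof -
  let ?W = "(\<lambda>(x, y, c). (x, y)) ` U"
  have op: "open (fst ` U)" using U(1) by (rule open_image_fst)
  have "open ?W"
  proof (rule Topological_Spaces.openI)
    fix q assume "q \<in> ?W"
    then obtain x y c where q: "q = (x, y)" "(x, y, c) \<in> U" by auto
    obtain A B' where A: "open A" "open B'" "(x, y, c) \<in> A \<times> B'" "A \<times> B' \<subseteq> U"
      using open_prod_elim[OF U(1) q(2)] by metis
    then have yc: "(y, c) \<in> B'" by simp
    have "q \<in> A \<times> fst ` B'" using A q yc by force
    moreover have "A \<times> fst ` B' \<subseteq> ?W" using A(4) by force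
    moreover have "open (A \<times> fst ` B')" using A by (intro open_Times open_image_fst)
    ultimately show "\<exists>T. open T \<and> q \<in> T \<and> T \<subseteq> ?W" by blast
  qed
  moreover have "?W \<subseteq> fst ` U \<times> UNIV" by force
  ultimately have V: "G_generator ?W (\<lambda>(x, y). (f x, y * g x))"
    using G_generator_linear[OF op _ _ fg] by blast
  have zero: "smooth_on (fst ` U) (\<lambda>_. 0 :: real)" using op by (rule smooth_on_const)
  have X: "GS_generator U (X_S f g (\<lambda>_. 0))"
    by (rule GS_generator_X_S[OF U(1) _ fg zero]) (use U(2) in auto)
  show ?thesis
    unfolding Gc_generator_def
    by (rule exI[of _ "X_S f g (\<lambda>_. 0)"], rule exI[of _ "\<lambda>(x, y). (f x, y * g x)"])
      (use X V Y in \<open>auto simp: X_S_def X_c_def Phi_zero[abs_def]\<close>)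
qed

section \<open>The symmetry and equivalence generators\<close>

theorem theorem1:
  fixes U :: "(real \<times> real \<times> (real ^ 'n::finite)) set"
  assumes "open U"
    and "\<And>x. connected {u. (x, u) \<in> U}"
    and "\<And>x y c. (x, y, c) \<in> U \<Longrightarrow> y \<noteq> 0"
  shows "(\<forall>f g h. smooth_on (fst ` U) f \<and> smooth_on (fst ` U) g \<and> smooth_on (fst ` U) h
            \<longrightarrow> GS_generator U (X_S f g h)) \<and>
         (2 \<le> CARD('n) \<longrightarrow> (\<forall>X. GS_generator U X \<longrightarrow>
            (\<exists>f g h. smooth_on (fst ` U) f \<and> smooth_on (fst ` U) g \<and> smooth_on (fst ` U) h \<and>
               (\<forall>p\<in>U. X p = X_S f g h p)))) \<and>
         (\<forall>Y. Gc_generator U Y \<longleftrightarrow>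
            (\<exists>f g. smooth_on (fst ` U) f \<and> smooth_on (fst ` U) g \<and>
               (\<forall>(x, y, c)\<in>U. Y (x, c) = X_c f g (x, c))))"
proof (intro conjI allI impI)
  fix f g h :: "real \<Rightarrow> real"
  assume "smooth_on (fst ` U) f \<and> smooth_on (fst ` U) g \<and> smooth_on (fst ` U) h"
  then show "GS_generator U (X_S f g h)"
    by (intro GS_generator_X_S[OF assms(1)]) (use assms(3) in auto)
next
  fix X assume n: "2 \<le> CARD('n)" and X: "GS_generator U X"
  obtain f g h where fgh: "smooth_on (fst ` U) f" "smooth_on (fst ` U) g" "smooth_on (fst ` U) h"
    and form: "\<And>p. p \<in> U \<Longrightarrow> fst (X p) = f (fst p)"
      "\<And>p. p \<in> U \<Longrightarrow> fst (snd (X p)) = fst (snd p) * g (fst p) + h (fst p)"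
    using GS_generator_affine[OF n assms(1,2) X] by blast
  have "X p = X_S f g h p" if "p \<in> U" for p
    by (rule GS_generator_affine_field_unique[OF assms(1) _ fgh X form that]) (use assms(3) in auto)
  with fgh show "\<exists>f g h. smooth_on (fst ` U) f \<and> smooth_on (fst ` U) g \<and> smooth_on (fst ` U) h \<and>
      (\<forall>p\<in>U. X p = X_S f g h p)" by blast
next
  fix Y
  show "Gc_generator U Y \<longleftrightarrow> (\<exists>f g. smooth_on (fst ` U) f \<and> smooth_on (fst ` U) g \<and>
      (\<forall>(x, y, c)\<in>U. Y (x, c) = X_c f g (x, c)))"
  proof
    assume "Gc_generator U Y"
    then show "\<exists>f g. smooth_on (fst ` U) f \<and> smooth_on (fst ` U) g \<and> (\<forall>(x, y, c)\<in>U. Y (x, c) = X_c f g (x, c))"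
      using Gc_generator_imp[OF assms(1,2)] assms(3) by blast
  next
    assume "\<exists>f g. smooth_on (fst ` U) f \<and> smooth_on (fst ` U) g \<and> (\<forall>(x, y, c)\<in>U. Y (x, c) = X_c f g (x, c))"
    then obtain f g where "smooth_on (fst ` U) f" "smooth_on (fst ` U) g"
      "\<And>x y c. (x, y, c) \<in> U \<Longrightarrow> Y (x, c) = X_c f g (x, c)" by fast
    then show "Gc_generator U Y"
      using Gc_generator_X_c[OF assms(1)] assms(3) by blast
  qed
qed

end
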